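(* Let $d\ge1$, $\mathcal{X}=[0,1)^d$, let $\mathcal{U}$ be the distribution of a random finite partition of $\mathcal{X}$ into hyper-rectangles, and let $X$ be uniformly distributed over $\mathcal{X}$. Assume $s:\mathcal{X}\to\mathbb{R}$ is differentiable on $\mathcal{X}$ and that there is $C_2>0$ such that for all $t,x\in\mathcal{X}$, $$|s(t)-s(x)-\nabla s(x)\cdot(t-x)|\le C_2\|t-x\|_2^2 .$$ Then for every $x\in\mathcal{X}$, $$\mathcal{M}_{1}^2-2|\mathcal{M}_{1}|\,\mathcal{R}_{2}\ \le\ \mathcal{B}_{\mathcal{U},\infty}(x)\ \le\ \big(|\mathcal{M}_{1}|+\mathcal{R}_{2}\big)^2$$ and $$\big|\mathcal{V}_{\mathcal{U}}(x)-(\mathcal{N}_{2}-\mathcal{M}_{1}^2)\big|\le 2\sqrt{\mathcal{R}_{4}\,(\mathcal{N}_{2}-\mathcal{M}_{1}^2)}+\mathcal{R}_{4}.$$ Furthermore, if also $s$ is twice differentiable on $\mathcal{X}$ and there is $C_3>0$ such that for all $t,x\in\mathcal{X}$ $$\Big|s(t)-s(x)-\nabla s(x)\cdot(t-x)-\tfrac12(t-x)^\top\nabla^{(2)}s(x)(t-x)\Big|\le C_3\|t-x\|_3^3$$ (which implies that the first inequality on $s$ holds with $C_2=\|\nabla^{(2)}s\|_{\infty,2}/2$), then for every $x\in\mathcal{X}$, $$\big|\mathcal{B}_{\mathcal{U},\infty}(x)-(\mathcal{M}_{1}+\mathcal{M}_{2})^2\big|\le 2\big|\mathcal{R}_{3}(\mathcal{M}_{1}+\mathcal{M}_{2})\big|+\mathcal{R}_{3}^2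 .$$
   Context: Each cell of a partition has the form $\lambda=\prod_{i=1}^d[A_i,B_i)$ with $0\le A_i<B_i\le1$. For $x\in\mathcal{X}$ and a partition $\mathbb{U}$, $I_{\mathbb{U}}(x)=\prod_{i=1}^d[A_{i,\mathbb{U}}(x),B_{i,\mathbb{U}}(x))$ is the unique cell of $\mathbb{U}$ containing $x$; since $X$ is uniform, $\tilde s_{\mathbb{U}}(x):=\mathbb{E}[s(X)\mid X\in I_{\mathbb U}(x)]=\frac{1}{|I_{\mathbb{U}}(x)|}\int_{I_{\mathbb{U}}(x)}s(t)\,dt$, with $|\cdot|$ the volume. Define $\mathcal{B}_{\mathcal{U},\infty}(x)=\big(s(x)-\mathbb{E}_{\mathbb{U}\sim\mathcal{U}}[\tilde s_{\mathbb{U}}(x)]\big)^2$ and $\mathcal{V}_{\mathcal{U}}(x)=\operatorname{var}_{\mathbb{U}\sim\mathcal{U}}(\tilde s_{\mathbb{U}}(x))$. Norms: $\|v\|_2^2=\sum_i v_i^2$, $\|v\|_3^3=\sum_i|v_i|^3$, $\|\nabla^{(2)}s\|_{\infty,2}=\sup_{\|v\|_2\le1,\,y\in\mathcal{X}}\big|\sum_{i,j}\frac{\partial^2 s(y)}{\partial x_i\partial x_j}v_iv_j\big|$. With $x$ fixed, $\mathbb{U}\sim\mathcal{U}$, $a_i=x_i-A_{i,\mathbb{U}}(x)$ and $b_i=B_{i,\mathbb{U}}(x)-x_i$, define $$\mathcal{M}_1=\tfrac12\sum_{i=1}^d\tfrac{\partial s}{\partial x_i}(x)\,\mathbb{E}[b_i-a_i],$$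 $$\mathcal{M}_2=\tfrac16\sum_{i=1}^d\tfrac{\partial^2 s}{\partial x_i^2}(x)\,\mathbb{E}[a_i^2+b_i^2-a_ib_i]+\tfrac18\sum_{1\le i\ne j\le d}\tfrac{\partial^2 s}{\partial x_i\partial x_j}(x)\,\mathbb{E}[(b_i-a_i)(b_j-a_j)],$$ $$\mathcal{N}_2=\tfrac14\sum_{i=1}^d\Big(\tfrac{\partial s}{\partial x_i}(x)\Big)^2\mathbb{E}[a_i^2+b_i^2-2a_ib_i]+\tfrac14\sum_{1\le i\ne j\le d}\tfrac{\partial s}{\partial x_i}(x)\tfrac{\partial s}{\partial x_j}(x)\,\mathbb{E}[(b_i-a_i)(b_j-a_j)],$$ $$\mathcal{R}_2=\tfrac{C_2}{3}\sum_{i=1}^d\mathbb{E}[a_i^2+b_i^2-a_ib_i],\quad \mathcal{R}_3=\tfrac{C_3}{4}\sum_{i=1}^d\mathbb{E}[a_i^3+b_i^3],\quad \mathcal{R}_4=\tfrac{2dC_2^2}{9}\sum_{i=1}^d\mathbb{E}[a_i^4+b_i^4].$$ *)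

theory Defs
  imports "HOL-Probability.Probability"
begin

definition hbox :: "real^'n \<Rightarrow> real^'n \<Rightarrow> (real^'n) set"
  where "hbox A B = {t. \<forall>i. A $ i \<le> t $ i \<and> t $ i < B $ i}"

definition unit_cube :: "(real^'n) set"
  where "unit_cube = {t. \<forall>i. 0 \<le> t $ i \<and> t $ i < 1}"

definition is_cell :: "(real^'n) set \<Rightarrow> bool"
  where "is_cell I \<longleftrightarrow> (\<exists>A B. (\<forall>i. 0 \<le> A $ i \<and> A $ i < B $ i \<and> B $ i \<le> 1) \<and> I = hbox A B)"

definition rect_partition :: "(real^'n) set set \<Rightarrow> bool"
  where "rect_partition U \<longleftrightarrow> finite U \<and> partition_on unit_cube U \<and> (\<forall>I\<in>U. is_cell I)"

definition cell :: "(real^'n) set set \<Rightarrow> real^'n \<Rightarrow> (real^'n) set"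
  where "cell U x = (THE I. I \<in> U \<and> x \<in> I)"

definition lower_corner :: "(real^'n) set \<Rightarrow> real^'n"
  where "lower_corner I = (THE A. \<exists>B. (\<forall>i. A $ i < B $ i) \<and> I = hbox A B)"

definition upper_corner :: "(real^'n) set \<Rightarrow> real^'n"
  where "upper_corner I = (THE B. \<exists>A. (\<forall>i. A $ i < B $ i) \<and> I = hbox A B)"

lemma hbox_subset_imp:
  fixes A B A' B' :: "real^'n"
  assumes AB: "\<forall>i. A $ i < B $ i" and sub: "hbox A B \<subseteq> hbox A' B'"
  shows "A' $ i \<le> A $ i \<and> B $ i \<le> B' $ i"
proof
  have "A \<in> hbox A B" using AB by (auto simp: hbox_def)
  then have A: "A \<in> hbox A' B'" using sub by blast
  then show "A' $ i \<le> A $ i" by (auto simp: hbox_def)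
  show "B $ i \<le> B' $ i"
  proof (rule ccontr)
    assume c: "\<not> B $ i \<le> B' $ i"
    define t where "t = (\<chi> j. if j = i then max (A $ i) (B' $ i) else A $ j)"
    have "t \<in> hbox A B" using AB c by (auto simp: hbox_def t_def)
    then have "t \<in> hbox A' B'" using sub by blast
    then have "t $ i < B' $ i" by (auto simp: hbox_def)
    then show False by (simp add: t_def)
  qed
qed

lemma hbox_inject:
  fixes A B A' B' :: "real^'n"
  assumes "\<forall>i. A $ i < B $ i" "\<forall>i. A' $ i < B' $ i" "hbox A B = hbox A' B'"
  shows "A = A' \<and> B = B'"
  using hbox_subset_imp[of A B A' B'] hbox_subset_imp[of A' B' A B] assms
  by (auto simp: vec_eq_iff intro: antisym)

lemma corner_hbox:
  fixes A B :: "real^'n"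
  assumes "\<forall>i. A $ i < B $ i"
  shows "lower_corner (hbox A B) = A" "upper_corner (hbox A B) = B"
  unfolding lower_corner_def upper_corner_def
  using assms hbox_inject by (blast intro!: the_equality)+

text \<open>
  A distribution over partitions is a probability measure on a set of partitions.  The
  \<sigma>-algebra is left open; it only has to make the corners of the cell containing any fixed
  point measurable, so that the expectations below are meaningful.
\<close>

definition random_partition :: "(real^'n) set set measure \<Rightarrow> bool"
  where "random_partition \<U> \<longleftrightarrow> prob_space \<U> \<and> (\<forall>U\<in>space \<U>. rect_partition U) \<and>
    (\<forall>x\<in>unit_cube. (\<lambda>U. lower_corner (cell U x)) \<in> borel_measurable \<U> \<and>
                   (\<lambda>U. upper_corner (cell U x)) \<in> borel_measurable \<U>)"

text \<open>
  \<open>cond_mean P X s I\<close> is \<open>E[s(X) | X \<in> I]\<close>.  It is written as a set integral because \<open>s\<close> is only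
  meaningful on the unit cube, so \<open>s \<circ> X\<close> need not be measurable on all of the sample space.
\<close>

definition cond_mean :: "'w measure \<Rightarrow> ('w \<Rightarrow> real^'n) \<Rightarrow> (real^'n \<Rightarrow> real) \<Rightarrow> (real^'n) set \<Rightarrow> real"
  where "cond_mean P X s I =
    (LINT \<omega>:(X -` I \<inter> space P)|P. s (X \<omega>)) / measure P (X -` I \<inter> space P)"

definition cell_mean :: "'w measure \<Rightarrow> ('w \<Rightarrow> real^'n) \<Rightarrow> (real^'n \<Rightarrow> real) \<Rightarrow> (real^'n) set set \<Rightarrow> real^'n \<Rightarrow> real"
  where "cell_mean P X s U x = cond_mean P X s (cell U x)"

definition uniform_on_cube :: "'w measure \<Rightarrow> ('w \<Rightarrow> real^'n) \<Rightarrow> bool"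
  where "uniform_on_cube P X \<longleftrightarrow> prob_space P \<and> X \<in> P \<rightarrow>\<^sub>M lborel \<and>
    distr P lborel X = uniform_measure lborel unit_cube"

definition sq_bias :: "'w measure \<Rightarrow> ('w \<Rightarrow> real^'n) \<Rightarrow> (real^'n) set set measure \<Rightarrow> (real^'n \<Rightarrow> real) \<Rightarrow> real^'n \<Rightarrow> real"
  where "sq_bias P X \<U> s x = (s x - (\<integral>U. cell_mean P X s U x \<partial>\<U>))\<^sup>2"

definition ens_variance :: "'w measure \<Rightarrow> ('w \<Rightarrow> real^'n) \<Rightarrow> (real^'n) set set measure \<Rightarrow> (real^'n \<Rightarrow> real) \<Rightarrow> real^'n \<Rightarrow> real"
  where "ens_variance P X \<U> s x =
    (\<integral>U. (cell_mean P X s U x - (\<integral>U'. cell_mean P X s U' x \<partial>\<U>))\<^sup>2 \<partial>\<U>)"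

lemma hbox_eq_vimage: "hbox A B = (\<Inter>i. {t. A $ i \<le> t $ i} \<inter> {t. t $ i < B $ i})"
  by (auto simp: hbox_def)

lemma hbox_borel [measurable]: "hbox A B \<in> sets borel"
  unfolding hbox_eq_vimage by (intro sets.finite_INT sets.Int) (auto intro!: borel_closed borel_open closed_Collect_le open_Collect_less continuous_intros)

lemma unit_cube_eq_hbox: "unit_cube = hbox 0 1"
  by (auto simp: unit_cube_def hbox_def)

lemma emeasure_unit_cube: "emeasure lborel (unit_cube :: (real^'n) set) = 1"
proof -
  have le: "\<And>b::real^'n. b \<in> Basis \<Longrightarrow> (0::real^'n) \<bullet> b \<le> 1 \<bullet> b"
    by (auto simp: Basis_vec_def inner_axis)
  have p: "(\<Prod>b\<in>(Basis::(real^'n) set). ((1::real^'n) - 0) \<bullet> b) = 1"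
    by (rule prod.neutral) (auto simp: Basis_vec_def inner_axis)
  have "emeasure lborel (box 0 (1::real^'n)) \<le> emeasure lborel (unit_cube :: (real^'n) set)"
    by (rule emeasure_mono) (auto simp: unit_cube_eq_hbox hbox_def mem_box Basis_vec_def inner_axis less_imp_le)
  moreover have "emeasure lborel (unit_cube :: (real^'n) set) \<le> emeasure lborel (cbox 0 (1::real^'n))"
    by (rule emeasure_mono) (auto simp: unit_cube_def mem_box Basis_vec_def inner_axis less_imp_le)
  ultimately show ?thesis using le p
    by (simp add: emeasure_lborel_box emeasure_lborel_cbox)
qed

lemma cond_mean_eq_average:
  fixes s :: "real^'n \<Rightarrow> real"
  assumes X: "uniform_on_cube P X" and I: "I \<in> sets borel" "I \<subseteq> unit_cube"
    and s: "set_borel_measurable lborel I s"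
  shows "cond_mean P X s I = (LINT t:I|lborel. s t) / measure lborel I"
proof -
  have mX [measurable]: "X \<in> P \<rightarrow>\<^sub>M lborel"
    and d: "distr P lborel X = uniform_measure lborel unit_cube"
    using X by (auto simp: uniform_on_cube_def)
  have cube: "unit_cube \<in> sets (lborel :: (real^'n) measure)"
    by (simp add: unit_cube_eq_hbox)
  have m: "(\<lambda>t. indicator I t *\<^sub>R s t) \<in> borel_measurable lborel"
    using s by (simp add: set_borel_measurable_def)
  have "measure P (X -` I \<inter> space P) = measure (distr P lborel X) I"
    using I by (subst measure_distr[OF mX]) simp_all
  also have "\<dots> = measure lborel I"
    using I cube by (simp add: d measure_def emeasure_uniform_measure emeasure_unit_cube Int_absorb1 divide_ennreal_def)
  finally have 1: "measure P (X -` I \<inter> space P) = measure lborel I" .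
  have "(LINT \<omega>:(X -` I \<inter> space P)|P. s (X \<omega>)) = (\<integral>\<omega>. indicator I (X \<omega>) *\<^sub>R s (X \<omega>) \<partial>P)"
    unfolding set_lebesgue_integral_def by (rule Bochner_Integration.integral_cong) (auto simp: indicator_def)
  also have "\<dots> = (\<integral>t. indicator I t *\<^sub>R s t \<partial>distr P lborel X)"
    by (rule integral_distr[symmetric, OF mX m])
  also have "\<dots> = (\<integral>t. indicator I t *\<^sub>R s t \<partial>density lborel (\<lambda>t. ennreal (indicator unit_cube t)))"
    by (simp add: d uniform_measure_def emeasure_unit_cube divide_ennreal_def ennreal_indicator)
  also have "\<dots> = (\<integral>t. indicator unit_cube t *\<^sub>R (indicator I t *\<^sub>R s t) \<partial>lborel)"
    using cube m by (intro integral_density) auto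
  also have "\<dots> = (LINT t:I|lborel. s t)"
    unfolding set_lebesgue_integral_def
    by (rule Bochner_Integration.integral_cong) (use I in \<open>auto simp: indicator_def\<close>)
  finally show ?thesis by (simp add: cond_mean_def 1)
qed

text \<open>
  Partial derivatives are taken within the unit cube, i.e. they are one-sided at points with a
  vanishing coordinate.  As the cube is half-open, every point admits increments \<open>h\<close> of at least
  one sign in each direction, so these derivatives are unique.
\<close>

definition partial :: "'n \<Rightarrow> (real^'n \<Rightarrow> real) \<Rightarrow> real^'n \<Rightarrow> real"
  where "partial i f x = vector_derivative (\<lambda>h. f (x + h *\<^sub>R axis i 1))
    (at 0 within {h. x + h *\<^sub>R axis i 1 \<in> unit_cube})"

definition grad :: "(real^'n \<Rightarrow> real) \<Rightarrow> real^'n \<Rightarrow> real^'n"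
  where "grad f x = (\<chi> i. partial i f x)"

definition hessian :: "(real^'n \<Rightarrow> real) \<Rightarrow> real^'n \<Rightarrow> real^'n^'n"
  where "hessian f x = (\<chi> i j. partial i (partial j f) x)"

definition twice_differentiable_on_cube :: "(real^'n \<Rightarrow> real) \<Rightarrow> bool"
  where "twice_differentiable_on_cube f \<longleftrightarrow>
    f differentiable_on unit_cube \<and> grad f differentiable_on unit_cube"

definition hess_values :: "(real^'n \<Rightarrow> real) \<Rightarrow> real set"
  where "hess_values f =
    {\<bar>\<Sum>i\<in>UNIV. \<Sum>j\<in>UNIV. hessian f y $ i $ j * v $ i * v $ j\<bar> | v y. norm v \<le> 1 \<and> y \<in> unit_cube}"

definition hess_norm :: "(real^'n \<Rightarrow> real) \<Rightarrow> real"
  where "hess_norm f = Sup (hess_values f)"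

definition first_order_bound :: "(real^'n \<Rightarrow> real) \<Rightarrow> real \<Rightarrow> bool"
  where "first_order_bound s C \<longleftrightarrow> (\<forall>t\<in>unit_cube. \<forall>x\<in>unit_cube.
    \<bar>s t - s x - grad s x \<bullet> (t - x)\<bar> \<le> C * (norm (t - x))\<^sup>2)"

definition second_order_bound :: "(real^'n \<Rightarrow> real) \<Rightarrow> real \<Rightarrow> bool"
  where "second_order_bound s C \<longleftrightarrow> (\<forall>t\<in>unit_cube. \<forall>x\<in>unit_cube.
    \<bar>s t - s x - grad s x \<bullet> (t - x) - 1/2 * ((t - x) \<bullet> (hessian s x *v (t - x)))\<bar>
      \<le> C * (\<Sum>i\<in>UNIV. \<bar>(t - x) $ i\<bar> ^ 3))"

definition a_len :: "real^'n \<Rightarrow> (real^'n) set set \<Rightarrow> 'n \<Rightarrow> real"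
  where "a_len x U i = x $ i - lower_corner (cell U x) $ i"

definition b_len :: "real^'n \<Rightarrow> (real^'n) set set \<Rightarrow> 'n \<Rightarrow> real"
  where "b_len x U i = upper_corner (cell U x) $ i - x $ i"

definition M1 :: "(real^'n) set set measure \<Rightarrow> (real^'n \<Rightarrow> real) \<Rightarrow> real^'n \<Rightarrow> real"
  where "M1 \<U> s x = 1/2 * (\<Sum>i\<in>UNIV. partial i s x * (\<integral>U. b_len x U i - a_len x U i \<partial>\<U>))"

definition M2 :: "(real^'n) set set measure \<Rightarrow> (real^'n \<Rightarrow> real) \<Rightarrow> real^'n \<Rightarrow> real"
  where "M2 \<U> s x =
    1/6 * (\<Sum>i\<in>UNIV. hessian s x $ i $ i *
            (\<integral>U. (a_len x U i)\<^sup>2 + (b_len x U i)\<^sup>2 - a_len x U i * b_len x U i \<partial>\<U>))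
  + 1/8 * (\<Sum>i\<in>UNIV. \<Sum>j\<in>UNIV - {i}. hessian s x $ i $ j *
            (\<integral>U. (b_len x U i - a_len x U i) * (b_len x U j - a_len x U j) \<partial>\<U>))"

definition N2 :: "(real^'n) set set measure \<Rightarrow> (real^'n \<Rightarrow> real) \<Rightarrow> real^'n \<Rightarrow> real"
  where "N2 \<U> s x =
    1/4 * (\<Sum>i\<in>UNIV. (partial i s x)\<^sup>2 *
            (\<integral>U. (a_len x U i)\<^sup>2 + (b_len x U i)\<^sup>2 - 2 * a_len x U i * b_len x U i \<partial>\<U>))
  + 1/4 * (\<Sum>i\<in>UNIV. \<Sum>j\<in>UNIV - {i}. partial i s x * partial j s x *
            (\<integral>U. (b_len x U i - a_len x U i) * (b_len x U j - a_len x U j) \<partial>\<U>))"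

definition R2 :: "(real^'n) set set measure \<Rightarrow> real \<Rightarrow> real^'n \<Rightarrow> real"
  where "R2 \<U> C x = C / 3 *
    (\<Sum>i\<in>UNIV. \<integral>U. (a_len x U i)\<^sup>2 + (b_len x U i)\<^sup>2 - a_len x U i * b_len x U i \<partial>\<U>)"

definition R3 :: "(real^'n) set set measure \<Rightarrow> real \<Rightarrow> real^'n \<Rightarrow> real"
  where "R3 \<U> C x = C / 4 * (\<Sum>i\<in>UNIV. \<integral>U. (a_len x U i) ^ 3 + (b_len x U i) ^ 3 \<partial>\<U>)"

definition R4 :: "(real^'n) set set measure \<Rightarrow> real \<Rightarrow> real^'n \<Rightarrow> real"
  where "R4 \<U> C x = 2 * real CARD('n) * C\<^sup>2 / 9 *
    (\<Sum>i\<in>UNIV. \<integral>U. (a_len x U i) ^ 4 + (b_len x U i) ^ 4 \<partial>\<U>)"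

end

theory Submission
  imports Defs
begin

text \<open>
  The mean of \<open>s\<close> over the cell of \<open>x\<close> is compared with the mean of the Taylor polynomial of \<open>s\<close>
  at \<open>x\<close>.  Under the uniform distribution on a box the coordinates are independent and uniform on
  the sides, so with \<open>a = x - A\<close> and \<open>b = B - x\<close> the mean of \<open>t\<^sub>i - x\<^sub>i\<close> is \<open>(b\<^sub>i - a\<^sub>i)/2\<close>, that of
  its square is \<open>(a\<^sub>i\<^sup>2 + b\<^sub>i\<^sup>2 - a\<^sub>i b\<^sub>i)/3\<close>, and mixed second moments factorise.  The first-order
  expansion therefore writes the cell mean as \<open>s x + L + r\<close>, where \<open>L\<close> is linear in \<open>b - a\<close> and
  \<open>\<bar>r\<bar> \<le> (C/3) \<Sum> (a\<^sub>i\<^sup>2 + b\<^sub>i\<^sup>2 - a\<^sub>i b\<^sub>i)\<close> (\<open>box_mean_first_order_remainder\<close>); the second-order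
  expansion adds a quadratic term and bounds the remainder by \<open>(C/4) \<Sum> (a\<^sub>i\<^sup>3 + b\<^sub>i\<^sup>3)\<close>
  (\<open>box_mean_second_order_remainder\<close>).

  Over the random partition, \<open>L\<close> has expectation \<open>M1\<close> and second moment \<open>N2\<close>, the quadratic term has
  expectation \<open>M2\<close>, and the remainder bounds have expectations \<open>R2\<close> and \<open>R3\<close>.  Expanding the square
  of a perturbed number gives the bounds on the bias.  For the variance, Cauchy-Schwarz bounds the
  covariance of \<open>L\<close> and \<open>r\<close> (\<open>variance_add_perturbation\<close>), and \<open>E[r\<^sup>2] \<le> R4\<close> follows from
  Cauchy-Schwarz over the \<open>d\<close> coordinates.

  That the second-order bound implies the first-order one with half the Hessian norm is Taylor's theorem
  with Lagrange remainder along the segment from \<open>x\<close> to \<open>t\<close>.  It also has to be shown that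
  the supremum defining this norm is finite, which is not immediate because the cube is not compact.
  Since \<open>s\<close> is bounded, the second difference \<open>s (y + 2u) - 2 s (y + u) + s y\<close> bounds the
  Hessian form at \<open>y\<close> in every direction \<open>u\<close> pointing into the cube; these directions fill an orthant,
  and the parallelogram identity reaches all the others (\<open>bdd_above_hess_values\<close>).
\<close>

section \<open>Integrals of product functions over boxes\<close>

lemma lborel_vec_integral_prod:
  fixes f :: "'n::finite \<Rightarrow> real \<Rightarrow> real"
  assumes f: "\<And>i. integrable lborel (f i)"
  shows "(\<integral>t. (\<Prod>i\<in>UNIV. f i ((t::real^'n) $ i)) \<partial>lborel) = (\<Prod>i\<in>UNIV. \<integral>x. f i x \<partial>lborel)"
proof -
  \<comment> \<open>Lebesgue measure is defined as a product over basis vectors; \<open>g\<close> is \<open>f\<close> indexed by \<open>axis i 1\<close>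
    instead of \<open>i\<close>.\<close>
  define g where "g b = f (SOME i. b = axis i (1::real))" for b :: "real^'n"
  have g: "g (axis i 1) = f i" for i
    by (simp add: g_def axis_eq_axis)
  have Basis: "(Basis :: (real^'n) set) = (\<lambda>i. axis i 1) ` UNIV"
    by (auto simp: Basis_vec_def)
  have inj: "inj (\<lambda>i::'n. axis i (1::real))"
    by (auto simp: inj_on_def axis_eq_axis)
  have prod_Basis: "(\<Prod>b\<in>(Basis::(real^'n) set). h b) = (\<Prod>i\<in>UNIV. h (axis i 1))" for h :: "_ \<Rightarrow> real"
    unfolding Basis using inj by (subst prod.reindex) auto
  have comp: "(\<Sum>b\<in>Basis. y b *\<^sub>R b) $ i = y (axis i 1)" for y :: "real^'n \<Rightarrow> real" and i
  proof -
    have "(\<Sum>b\<in>Basis. y b *\<^sub>R b) $ i = (\<Sum>b\<in>Basis. y b *\<^sub>R b) \<bullet> axis i 1"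
      by (simp add: inner_axis)
    also have "\<dots> = y (axis i 1)"
      by (rule inner_sum_left_Basis) (auto simp: Basis)
    finally show ?thesis .
  qed
  interpret product_sigma_finite "\<lambda>b::real^'n. lborel :: real measure"
    by standard
  have [measurable]: "f i \<in> borel_measurable borel" for i
    using f[of i] by auto
  have "(\<integral>t. (\<Prod>i\<in>UNIV. f i ((t::real^'n) $ i)) \<partial>lborel)
      = (\<integral>y. (\<Prod>i\<in>UNIV. f i ((\<Sum>b\<in>Basis. y b *\<^sub>R b :: real^'n) $ i)) \<partial>(\<Pi>\<^sub>M b\<in>Basis. lborel))"
    by (subst lborel_eq, rule integral_distr) measurable
  also have "\<dots> = (\<integral>y. (\<Prod>b\<in>(Basis::(real^'n) set). g b (y b)) \<partial>(\<Pi>\<^sub>M b\<in>Basis. lborel))"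
    by (simp only: comp prod_Basis g)
  also have "\<dots> = (\<Prod>b\<in>(Basis::(real^'n) set). \<integral>x. g b x \<partial>lborel)"
    by (rule product_integral_prod) (use f in \<open>auto simp: Basis g\<close>)
  finally show ?thesis by (simp add: prod_Basis g)
qed

lemma indicator_hbox:
  "indicator (hbox A B) t = (\<Prod>i\<in>UNIV. indicator {A $ i..<B $ i} (t $ i) :: real)"
proof (cases "t \<in> hbox A B")
  case True
  then have "t $ i \<in> {A $ i..<B $ i}" for i by (simp add: hbox_def)
  with True show ?thesis by simp
next
  case False
  then obtain i where "t $ i \<notin> {A $ i..<B $ i}" unfolding hbox_def by force
  then have "\<exists>i\<in>UNIV. indicator {A $ i..<B $ i} (t $ i) = (0::real)"
    using indicator_simps(2) by (intro bexI[of _ i] UNIV_I)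
  then have "(\<Prod>i\<in>UNIV. indicator {A $ i..<B $ i} (t $ i) :: real) = 0"
    by (rule prod_zero[OF finite])
  with False show ?thesis by simp
qed

lemma set_integral_hbox_prod:
  fixes f :: "'n::finite \<Rightarrow> real \<Rightarrow> real"
  assumes "\<And>i. set_integrable lborel {A $ i..<B $ i} (f i)"
  shows "(LINT t:hbox A B|lborel. (\<Prod>i\<in>UNIV. f i (t $ i)))
    = (\<Prod>i\<in>UNIV. LINT x:{A $ i..<B $ i}|lborel. f i x)"
  using lborel_vec_integral_prod[of "\<lambda>i x. indicator {A $ i..<B $ i} x *\<^sub>R f i x"] assms
  by (simp add: set_lebesgue_integral_def set_integrable_def indicator_hbox prod.distrib)

lemma emeasure_hbox_finite [simp]: "emeasure lborel (hbox A B) < \<infinity>"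
proof -
  have "emeasure lborel (hbox A B) \<le> emeasure lborel (cbox A B)"
    by (intro emeasure_mono) (auto simp: hbox_def mem_box_cart less_imp_le)
  also have "\<dots> < \<infinity>" by (rule emeasure_lborel_cbox_finite)
  finally show ?thesis .
qed

lemma set_integrable_hbox_const [simp]: "set_integrable lborel (hbox A B) (\<lambda>_. c::real)"
  using emeasure_hbox_finite[of A B] by (simp add: set_integrable_def)

lemma measure_hbox:
  fixes A B :: "real^'n"
  assumes "\<And>i. A $ i \<le> B $ i"
  shows "measure lborel (hbox A B) = (\<Prod>i\<in>UNIV. B $ i - A $ i)"
proof -
  have "measure lborel (hbox A B) = (LINT t:hbox A B|lborel. (\<Prod>i\<in>(UNIV :: 'n set). (1::real)))"
    by (simp add: set_lebesgue_integral_def)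
  also have "\<dots> = (\<Prod>i\<in>UNIV. LINT x:{A $ i..<B $ i}|lborel. (1::real))"
    by (rule set_integral_hbox_prod) (simp add: assms set_integrable_def)
  also have "\<dots> = (\<Prod>i\<in>UNIV. B $ i - A $ i)"
    using assms by (simp add: set_lebesgue_integral_def)
  finally show ?thesis .
qed

section \<open>Means over boxes and their moments\<close>

text \<open>
  The mean value of a function over a box, and over a half-open interval; both are 0 on an empty domain.
\<close>

definition box_mean :: "real^'n \<Rightarrow> real^'n \<Rightarrow> (real^'n \<Rightarrow> real) \<Rightarrow> real"
  where "box_mean A B f = (LINT t:hbox A B|lborel. f t) / measure lborel (hbox A B)"

definition interval_mean :: "real \<Rightarrow> real \<Rightarrow> (real \<Rightarrow> real) \<Rightarrow> real"
  where "interval_mean a b f = (LINT x:{a..<b}|lborel. f x) / (b - a)"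

lemma set_integrable_continuous_interval:
  fixes f :: "real \<Rightarrow> real"
  assumes "continuous_on {a..b} f"
  shows "set_integrable lborel {a..<b} f"
  by (rule set_integrable_subset[OF borel_integrable_atLeastAtMost'[OF assms]]) auto

lemma set_integrable_continuous_hbox:
  fixes f :: "real^'n \<Rightarrow> real"
  assumes "continuous_on UNIV f"
  shows "set_integrable lborel (hbox A B) f"
proof (rule set_integrable_subset)
  show "set_integrable lborel (cbox A B) f"
    unfolding set_integrable_def
    by (rule borel_integrable_compact) (auto intro: continuous_on_subset[OF assms])
qed (auto simp: hbox_def mem_box_cart less_imp_le)

lemma box_mean_prod:
  fixes f :: "'n::finite \<Rightarrow> real \<Rightarrow> real"
  assumes "\<And>i. A $ i \<le> B $ i" and "\<And>i. set_integrable lborel {A $ i..<B $ i} (f i)"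
  shows "box_mean A B (\<lambda>t. \<Prod>i\<in>UNIV. f i (t $ i)) = (\<Prod>i\<in>UNIV. interval_mean (A $ i) (B $ i) (f i))"
  using assms by (simp add: box_mean_def interval_mean_def set_integral_hbox_prod measure_hbox prod_dividef)

lemma interval_mean_const: "a < b \<Longrightarrow> interval_mean a b (\<lambda>_. c) = c"
  by (simp add: interval_mean_def set_lebesgue_integral_def)

lemma box_mean_coord2:
  fixes A B :: "real^'n"
  assumes AB: "\<And>i. A $ i < B $ i" and "i \<noteq> j" "continuous_on UNIV f" "continuous_on UNIV g"
  shows "box_mean A B (\<lambda>t. f (t $ i) * g (t $ j))
    = interval_mean (A $ i) (B $ i) f * interval_mean (A $ j) (B $ j) g"
proof -
  \<comment> \<open>All other coordinates contribute the factor 1.\<close>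
  define h where "h k = (if k = i then f else if k = j then g else (\<lambda>_. 1))" for k
  have "continuous_on UNIV (h k)" for k
    using assms by (auto simp: h_def)
  then have h: "set_integrable lborel {A $ k..<B $ k} (h k)" for k
    by (intro set_integrable_continuous_interval) (blast intro: continuous_on_subset)
  have pick: "(\<Prod>k\<in>UNIV. if k = i then u k else if k = j then v k else 1) = u i * v j"
    for u v :: "'n \<Rightarrow> real"
  proof -
    have "(\<Prod>k\<in>UNIV. if k = i then u k else if k = j then v k else 1)
      = (\<Prod>k\<in>UNIV. (if k = i then u k else 1) * (if k = j then v k else 1))"
      using \<open>i \<noteq> j\<close> by (intro prod.cong) auto
    then show ?thesis by (simp add: prod.distrib)
  qed
  have "box_mean A B (\<lambda>t. f (t $ i) * g (t $ j)) = box_mean A B (\<lambda>t. \<Prod>k\<in>UNIV. h k (t $ k))"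
    by (simp add: h_def if_distrib[of "\<lambda>F. F _"] pick cong: if_cong)
  also have "\<dots> = (\<Prod>k\<in>UNIV. interval_mean (A $ k) (B $ k) (h k))"
    by (rule box_mean_prod) (use AB h in \<open>auto simp: less_imp_le\<close>)
  also have "\<dots> = (\<Prod>k\<in>UNIV. if k = i then interval_mean (A $ k) (B $ k) f
      else if k = j then interval_mean (A $ k) (B $ k) g else 1)"
    by (rule prod.cong) (auto simp: h_def AB interval_mean_const)
  finally show ?thesis by (simp add: pick)
qed

lemma box_mean_coord:
  fixes A B :: "real^'n"
  assumes AB: "\<And>i. A $ i < B $ i" and f: "continuous_on UNIV f"
  shows "box_mean A B (\<lambda>t. f (t $ i)) = interval_mean (A $ i) (B $ i) f"
proof -
  define h where "h k = (if k = i then f else (\<lambda>_. 1))" for k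
  have "continuous_on UNIV (h k)" for k
    using assms by (auto simp: h_def)
  then have h: "set_integrable lborel {A $ k..<B $ k} (h k)" for k
    by (intro set_integrable_continuous_interval) (blast intro: continuous_on_subset)
  have "box_mean A B (\<lambda>t. f (t $ i)) = box_mean A B (\<lambda>t. \<Prod>k\<in>UNIV. h k (t $ k))"
    by (simp add: h_def if_distrib[of "\<lambda>F. F _"] cong: if_cong)
  also have "\<dots> = (\<Prod>k\<in>UNIV. interval_mean (A $ k) (B $ k) (h k))"
    by (rule box_mean_prod) (use AB h in \<open>auto simp: less_imp_le\<close>)
  also have "\<dots> = (\<Prod>k\<in>UNIV. if k = i then interval_mean (A $ k) (B $ k) f else 1)"
    by (rule prod.cong) (auto simp: h_def AB interval_mean_const)
  finally show ?thesis by simp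
qed

lemma set_integral_power:
  assumes "a \<le> b"
  shows "(LINT x:{a..<b}|lborel. (x - c) ^ k) = ((b - c) ^ Suc k - (a - c) ^ Suc k) / Suc k"
proof -
  have "(LINT x:{a..<b}|lborel. (x - c) ^ k) = (\<integral>x. (x - c) ^ k * indicator {a..b} x \<partial>lborel)"
    unfolding set_lebesgue_integral_def
    by (rule integral_cong_AE) (use AE_lborel_singleton[of b] in \<open>auto simp: indicator_def elim!: eventually_mono\<close>)
  also have "\<dots> = (b - c) ^ Suc k / Suc k - (a - c) ^ Suc k / Suc k"
  proof (rule integral_FTC_Icc_real[OF assms])
    fix x show "((\<lambda>x. (x - c) ^ Suc k / Suc k) has_real_derivative (x - c) ^ k) (at x)"
      by (intro derivative_eq_intros) (auto simp del: of_nat_Suc)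
  qed (auto intro!: continuous_intros)
  finally show ?thesis by (simp add: diff_divide_distrib)
qed

lemma interval_mean_1:
  assumes "a < b" shows "interval_mean a b (\<lambda>x. x - c) = ((b - c) - (c - a)) / 2"
  using assms set_integral_power[of a b c 1]
  by (simp add: interval_mean_def field_simps power2_eq_square)

lemma interval_mean_2:
  assumes "a < b"
  shows "interval_mean a b (\<lambda>x. (x - c)\<^sup>2) = ((c - a)\<^sup>2 + (b - c)\<^sup>2 - (c - a) * (b - c)) / 3"
  using assms set_integral_power[of a b c 2]
  by (simp add: interval_mean_def field_simps power2_eq_square power3_eq_cube)

lemma interval_mean_abs3:
  assumes "a \<le> c" "c < b"
  shows "interval_mean a b (\<lambda>x. \<bar>x - c\<bar> ^ 3) \<le> ((c - a) ^ 3 + (b - c) ^ 3) / 4"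
proof -
  let ?L = "\<lambda>S f. LINT x:S|(lborel :: real measure). (f x :: real)"
  have int: "set_integrable lborel {u..<v} (\<lambda>x. \<bar>x - c\<bar> ^ 3)" for u v
    by (intro set_integrable_continuous_interval continuous_intros)
  have "?L {a..<b} (\<lambda>x. \<bar>x - c\<bar> ^ 3) = ?L ({a..<c} \<union> {c..<b}) (\<lambda>x. \<bar>x - c\<bar> ^ 3)"
    using assms by (simp add: ivl_disj_un)
  also have "\<dots> = ?L {a..<c} (\<lambda>x. \<bar>x - c\<bar> ^ 3) + ?L {c..<b} (\<lambda>x. \<bar>x - c\<bar> ^ 3)"
    by (rule set_integral_Un) (auto intro: int)
  also have "?L {a..<c} (\<lambda>x. \<bar>x - c\<bar> ^ 3) = ?L {a..<c} (\<lambda>x. - ((x - c) ^ 3))"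
  proof (rule set_lebesgue_integral_cong)
    have "\<bar>x - c\<bar> ^ 3 = - ((x - c) ^ 3)" if "x < c" for x
    proof -
      have "\<bar>x - c\<bar> = - (x - c)" using that by simp
      then have "\<bar>x - c\<bar> ^ 3 = (- (x - c)) ^ 3" by (rule arg_cong)
      also have "\<dots> = - ((x - c) ^ 3)" by (rule power_minus_odd) simp
      finally show ?thesis .
    qed
    then show "\<forall>x. x \<in> {a..<c} \<longrightarrow> \<bar>x - c\<bar> ^ 3 = - ((x - c) ^ 3)" by simp
  qed simp
  also have "\<dots> = (c - a) ^ 4 / 4"
    using assms set_integral_power[of a c c 3] int[of a c]
    by (subst set_integral_uminus)
      (auto intro!: set_integrable_continuous_interval continuous_intros simp: power4_eq_xxxx algebra_simps)
  also have "?L {c..<b} (\<lambda>x. \<bar>x - c\<bar> ^ 3) = ?L {c..<b} (\<lambda>x. (x - c) ^ 3)"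
    by (rule set_lebesgue_integral_cong) auto
  also have "\<dots> = (b - c) ^ 4 / 4"
    using assms set_integral_power[of c b c 3] by simp
  \<comment> \<open>It remains to compare \<open>(u\<^sup>4 + v\<^sup>4)/(4(u + v))\<close>, the exact mean, with \<open>(u\<^sup>3 + v\<^sup>3)/4\<close>.\<close>
  finally have eq: "?L {a..<b} (\<lambda>x. \<bar>x - c\<bar> ^ 3) = ((c - a) ^ 4 + (b - c) ^ 4) / 4" by simp
  define u v where "u = c - a" and "v = b - c"
  have uv: "0 \<le> u" "0 < v" using assms by (auto simp: u_def v_def)
  have "u ^ 4 + v ^ 4 \<le> u ^ 4 + v ^ 4 + (u ^ 3 * v + u * v ^ 3)"
    using uv by simp
  also have "\<dots> = (u ^ 3 + v ^ 3) * (u + v)" by algebra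
  finally have "(u ^ 4 + v ^ 4) / 4 / (u + v) \<le> (u ^ 3 + v ^ 3) / 4"
    using uv by (simp add: field_simps)
  moreover have "u + v = b - a" by (simp add: u_def v_def)
  ultimately show ?thesis
    by (simp only: interval_mean_def eq u_def [symmetric] v_def [symmetric])
qed

lemma measure_hbox_pos:
  fixes A B :: "real^'n"
  assumes "\<And>i. A $ i < B $ i" shows "measure lborel (hbox A B) > 0"
  using assms by (subst measure_hbox) (auto intro!: prod_pos simp: less_imp_le)

lemma box_mean_const:
  fixes A B :: "real^'n"
  assumes "\<And>i. A $ i < B $ i" shows "box_mean A B (\<lambda>_. c) = c"
  using measure_hbox_pos[OF assms] by (simp add: box_mean_def set_lebesgue_integral_def)

lemma box_mean_add:
  assumes "set_integrable lborel (hbox A B) f" "set_integrable lborel (hbox A B) g"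
  shows "box_mean A B (\<lambda>t. f t + g t) = box_mean A B f + box_mean A B g"
  using assms by (simp add: box_mean_def add_divide_distrib)

lemma box_mean_cmult: "box_mean A B (\<lambda>t. c * f t) = c * box_mean A B f"
  by (simp add: box_mean_def)

lemma box_mean_sum:
  assumes "\<And>k. k \<in> S \<Longrightarrow> set_integrable lborel (hbox A B) (f k)"
  shows "box_mean A B (\<lambda>t. \<Sum>k\<in>S. f k t) = (\<Sum>k\<in>S. box_mean A B (f k))"
proof -
  have "(LINT t:hbox A B|lborel. (\<Sum>k\<in>S. f k t)) = (\<Sum>k\<in>S. LINT t:hbox A B|lborel. f k t)"
    using assms unfolding set_lebesgue_integral_def set_integrable_def scaleR_sum_right
    by (rule Bochner_Integration.integral_sum)
  then show ?thesis by (simp add: box_mean_def sum_divide_distrib)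
qed

lemma abs_box_mean_diff_le:
  assumes f: "set_integrable lborel (hbox A B) f" and g: "set_integrable lborel (hbox A B) g"
    and e: "set_integrable lborel (hbox A B) e"
    and le: "\<And>t. t \<in> hbox A B \<Longrightarrow> \<bar>f t - g t\<bar> \<le> e t"
  shows "\<bar>box_mean A B f - box_mean A B g\<bar> \<le> box_mean A B e"
proof -
  let ?L = "\<lambda>f. LINT t:hbox A B|lborel. f t :: real"
  have d: "set_integrable lborel (hbox A B) (\<lambda>t. f t - g t)"
    using f g by (rule set_integral_diff)
  have "?L f - ?L g = ?L (\<lambda>t. f t - g t)" using f g by simp
  also have "\<bar>\<dots>\<bar> \<le> ?L e"
  proof -
    have "?L (\<lambda>t. f t - g t) \<le> ?L e"
      by (rule set_integral_mono[OF d e]) (use le in force)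
    moreover have "?L (\<lambda>t. - e t) \<le> ?L (\<lambda>t. f t - g t)"
    proof (rule set_integral_mono[OF _ d])
      show "set_integrable lborel (hbox A B) (\<lambda>t. - e t)"
        using e by (simp add: set_integrable_def)
    qed (use le in force)
    ultimately show ?thesis using set_integral_uminus[OF e] by simp
  qed
  finally show ?thesis
    by (simp add: box_mean_def flip: diff_divide_distrib) (simp add: divide_right_mono)
qed

lemma box_mean_affine:
  fixes A B x g :: "real^'n"
  assumes AB: "\<And>i. A $ i < B $ i"
  shows "box_mean A B (\<lambda>t. c + g \<bullet> (t - x)) = c + 1/2 * (\<Sum>i\<in>UNIV. g $ i * ((B $ i - x $ i) - (x $ i - A $ i)))"
proof -
  have "box_mean A B (\<lambda>t. c + g \<bullet> (t - x)) = box_mean A B (\<lambda>t. c + (\<Sum>i\<in>UNIV. g $ i * (t $ i - x $ i)))"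
    by (simp add: inner_vec_def)
  also have "\<dots> = box_mean A B (\<lambda>t. c) + box_mean A B (\<lambda>t. \<Sum>i\<in>UNIV. g $ i * (t $ i - x $ i))"
    by (rule box_mean_add) (intro set_integrable_continuous_hbox continuous_intros)+
  also have "box_mean A B (\<lambda>t. \<Sum>i\<in>UNIV. g $ i * (t $ i - x $ i))
      = (\<Sum>i\<in>UNIV. box_mean A B (\<lambda>t. g $ i * (t $ i - x $ i)))"
    by (rule box_mean_sum) (intro set_integrable_continuous_hbox continuous_intros)
  also have "(\<Sum>i\<in>UNIV. box_mean A B (\<lambda>t. g $ i * (t $ i - x $ i)))
      = (\<Sum>i\<in>UNIV. g $ i * (((B $ i - x $ i) - (x $ i - A $ i)) / 2))"
  proof (rule sum.cong)
    fix i
    show "box_mean A B (\<lambda>t. g $ i * (t $ i - x $ i)) = g $ i * (((B $ i - x $ i) - (x $ i - A $ i)) / 2)"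
      using box_mean_coord[OF AB, of "\<lambda>y. y - x $ i" i] interval_mean_1[OF AB, of i "x $ i"]
      by (simp add: box_mean_cmult continuous_intros)
  qed simp
  finally show ?thesis by (simp add: box_mean_const AB sum_distrib_left)
qed

lemma box_mean_coord_sq:
  fixes A B x :: "real^'n"
  assumes AB: "\<And>i. A $ i < B $ i"
  shows "box_mean A B (\<lambda>t. (t $ i - x $ i)\<^sup>2)
    = ((x $ i - A $ i)\<^sup>2 + (B $ i - x $ i)\<^sup>2 - (x $ i - A $ i) * (B $ i - x $ i)) / 3"
  using box_mean_coord[OF AB, of "\<lambda>y. (y - x $ i)\<^sup>2" i] interval_mean_2[OF AB, of i "x $ i"]
  by (simp add: continuous_intros)

lemma box_mean_norm_sq:
  fixes A B x :: "real^'n"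
  assumes AB: "\<And>i. A $ i < B $ i"
  shows "box_mean A B (\<lambda>t. (norm (t - x))\<^sup>2)
    = 1/3 * (\<Sum>i\<in>UNIV. (x $ i - A $ i)\<^sup>2 + (B $ i - x $ i)\<^sup>2 - (x $ i - A $ i) * (B $ i - x $ i))"
proof -
  have "box_mean A B (\<lambda>t. (norm (t - x))\<^sup>2) = box_mean A B (\<lambda>t. \<Sum>i\<in>UNIV. (t $ i - x $ i)\<^sup>2)"
    by (simp add: power2_norm_eq_inner inner_vec_def) (simp add: power2_eq_square)
  also have "\<dots> = (\<Sum>i\<in>UNIV. box_mean A B (\<lambda>t. (t $ i - x $ i)\<^sup>2))"
    by (rule box_mean_sum) (intro set_integrable_continuous_hbox continuous_intros)
  finally show ?thesis
    by (simp only: box_mean_coord_sq[OF AB] sum_distrib_left) simp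
qed

lemma box_mean_abs_cubed_le:
  fixes A B x :: "real^'n"
  assumes AB: "\<And>i. A $ i \<le> x $ i" "\<And>i. x $ i < B $ i"
  shows "box_mean A B (\<lambda>t. \<Sum>i\<in>UNIV. \<bar>(t - x) $ i\<bar> ^ 3)
    \<le> 1/4 * (\<Sum>i\<in>UNIV. (x $ i - A $ i) ^ 3 + (B $ i - x $ i) ^ 3)"
proof -
  have less: "\<And>i. A $ i < B $ i" using AB by (meson le_less_trans)
  have "box_mean A B (\<lambda>t. \<Sum>i\<in>UNIV. \<bar>(t - x) $ i\<bar> ^ 3) = (\<Sum>i\<in>UNIV. box_mean A B (\<lambda>t. \<bar>(t - x) $ i\<bar> ^ 3))"
    by (rule box_mean_sum) (intro set_integrable_continuous_hbox continuous_intros)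
  also have "\<dots> \<le> (\<Sum>i\<in>UNIV. ((x $ i - A $ i) ^ 3 + (B $ i - x $ i) ^ 3) / 4)"
  proof (rule sum_mono)
    fix i
    show "box_mean A B (\<lambda>t. \<bar>(t - x) $ i\<bar> ^ 3) \<le> ((x $ i - A $ i) ^ 3 + (B $ i - x $ i) ^ 3) / 4"
      using box_mean_coord[OF less, of "\<lambda>y. \<bar>y - x $ i\<bar> ^ 3" i]
        interval_mean_abs3[OF AB, of i]
      by (simp add: continuous_intros)
  qed
  finally show ?thesis by (simp add: sum_distrib_left)
qed

lemma box_mean_quadratic_form:
  fixes A B x :: "real^'n" and H :: "real^'n^'n"
  assumes AB: "\<And>i. A $ i < B $ i"
  shows "box_mean A B (\<lambda>t. (t - x) \<bullet> (H *v (t - x)))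
    = 1/3 * (\<Sum>i\<in>UNIV. H $ i $ i * ((x $ i - A $ i)\<^sup>2 + (B $ i - x $ i)\<^sup>2 - (x $ i - A $ i) * (B $ i - x $ i)))
    + 1/4 * (\<Sum>i\<in>UNIV. \<Sum>j\<in>UNIV - {i}. H $ i $ j *
        (((B $ i - x $ i) - (x $ i - A $ i)) * ((B $ j - x $ j) - (x $ j - A $ j))))"
    (is "_ = 1/3 * ?diag + 1/4 * ?off")
proof -
  let ?d = "\<lambda>i. (B $ i - x $ i) - (x $ i - A $ i)"
  let ?q = "\<lambda>i. (x $ i - A $ i)\<^sup>2 + (B $ i - x $ i)\<^sup>2 - (x $ i - A $ i) * (B $ i - x $ i)"
  have "box_mean A B (\<lambda>t. (t - x) \<bullet> (H *v (t - x)))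
      = box_mean A B (\<lambda>t. \<Sum>i\<in>UNIV. \<Sum>j\<in>UNIV. H $ i $ j * ((t $ i - x $ i) * (t $ j - x $ j)))"
    by (simp add: inner_vec_def matrix_vector_mult_def sum_distrib_left mult_ac)
  also have "\<dots> = (\<Sum>i\<in>UNIV. \<Sum>j\<in>UNIV. H $ i $ j * box_mean A B (\<lambda>t. (t $ i - x $ i) * (t $ j - x $ j)))"
    by (simp add: box_mean_sum box_mean_cmult set_integrable_continuous_hbox continuous_intros)
  also have "\<dots> = (\<Sum>i\<in>UNIV. H $ i $ i * (?q i / 3) + (\<Sum>j\<in>UNIV - {i}. H $ i $ j * (?d i * ?d j / 4)))"
  proof (rule sum.cong[OF refl])
    fix i
    have diag: "box_mean A B (\<lambda>t. (t $ i - x $ i) * (t $ i - x $ i)) = ?q i / 3"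
      using box_mean_coord_sq[OF AB, of i x] by (simp add: power2_eq_square)
    have off: "box_mean A B (\<lambda>t. (t $ i - x $ i) * (t $ j - x $ j)) = ?d i * ?d j / 4" if "j \<noteq> i" for j
      using box_mean_coord2[OF AB, of i j "\<lambda>y. y - x $ i" "\<lambda>y. y - x $ j"] that
        interval_mean_1[OF AB, of i "x $ i"] interval_mean_1[OF AB, of j "x $ j"]
      by (simp add: continuous_intros)
    have "(\<Sum>j\<in>UNIV - {i}. H $ i $ j * box_mean A B (\<lambda>t. (t $ i - x $ i) * (t $ j - x $ j)))
        = (\<Sum>j\<in>UNIV - {i}. H $ i $ j * (?d i * ?d j / 4))"
      by (rule sum.cong) (auto simp: off)
    then show "(\<Sum>j\<in>UNIV. H $ i $ j * box_mean A B (\<lambda>t. (t $ i - x $ i) * (t $ j - x $ j)))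
        = H $ i $ i * (?q i / 3) + (\<Sum>j\<in>UNIV - {i}. H $ i $ j * (?d i * ?d j / 4))"
      by (simp add: sum.remove[of UNIV i] diag)
  qed
  also have "\<dots> = 1/3 * ?diag + 1/4 * ?off"
    by (simp add: sum.distrib sum_distrib_left)
  finally show ?thesis .
qed

section \<open>Averaged Taylor expansions\<close>

lemma hbox_subset_unit_cube:
  fixes A B :: "real^'n"
  assumes "\<And>i. 0 \<le> A $ i" "\<And>i. B $ i \<le> 1"
  shows "hbox A B \<subseteq> unit_cube"
  using assms unfolding hbox_def unit_cube_def by (fastforce intro: order_trans less_le_trans)

lemma box_mean_first_order_remainder:
  fixes A B x :: "real^'n"
  assumes A: "\<And>i. 0 \<le> A $ i" "\<And>i. A $ i \<le> x $ i" and B: "\<And>i. x $ i < B $ i" "\<And>i. B $ i \<le> 1"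
    and s: "set_integrable lborel (hbox A B) s" and bound: "first_order_bound s C"
  shows "\<bar>box_mean A B s - (s x + 1/2 * (\<Sum>i\<in>UNIV. partial i s x * ((B $ i - x $ i) - (x $ i - A $ i))))\<bar>
    \<le> C / 3 * (\<Sum>i\<in>UNIV. (x $ i - A $ i)\<^sup>2 + (B $ i - x $ i)\<^sup>2 - (x $ i - A $ i) * (B $ i - x $ i))"
proof -
  have AB: "\<And>i. A $ i < B $ i" using A B by (meson le_less_trans)
  have sub: "hbox A B \<subseteq> unit_cube" by (rule hbox_subset_unit_cube[OF A(1) B(2)])
  have x: "x \<in> unit_cube"
    using sub A B by (auto simp: hbox_def)
  have "\<bar>box_mean A B s - box_mean A B (\<lambda>t. s x + grad s x \<bullet> (t - x))\<bar>
      \<le> box_mean A B (\<lambda>t. C * (norm (t - x))\<^sup>2)"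
  proof (rule abs_box_mean_diff_le[OF s])
    fix t assume "t \<in> hbox A B"
    then have "\<bar>s t - s x - grad s x \<bullet> (t - x)\<bar> \<le> C * (norm (t - x))\<^sup>2"
      using bound sub x by (auto simp: first_order_bound_def)
    then show "\<bar>s t - (s x + grad s x \<bullet> (t - x))\<bar> \<le> C * (norm (t - x))\<^sup>2"
      by (simp add: algebra_simps)
  qed (intro set_integrable_continuous_hbox continuous_intros)+
  then show ?thesis
    by (simp add: box_mean_affine[OF AB] box_mean_cmult box_mean_norm_sq[OF AB] grad_def)
qed

lemma box_mean_second_order_remainder:
  fixes A B x :: "real^'n"
  assumes A: "\<And>i. 0 \<le> A $ i" "\<And>i. A $ i \<le> x $ i" and B: "\<And>i. x $ i < B $ i" "\<And>i. B $ i \<le> 1"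
    and s: "set_integrable lborel (hbox A B) s" and bound: "second_order_bound s C" and C: "0 \<le> C"
  shows "\<bar>box_mean A B s - (s x + 1/2 * (\<Sum>i\<in>UNIV. partial i s x * ((B $ i - x $ i) - (x $ i - A $ i)))
      + (1/6 * (\<Sum>i\<in>UNIV. hessian s x $ i $ i *
          ((x $ i - A $ i)\<^sup>2 + (B $ i - x $ i)\<^sup>2 - (x $ i - A $ i) * (B $ i - x $ i)))
        + 1/8 * (\<Sum>i\<in>UNIV. \<Sum>j\<in>UNIV - {i}. hessian s x $ i $ j *
          (((B $ i - x $ i) - (x $ i - A $ i)) * ((B $ j - x $ j) - (x $ j - A $ j))))))\<bar>
    \<le> C / 4 * (\<Sum>i\<in>UNIV. (x $ i - A $ i) ^ 3 + (B $ i - x $ i) ^ 3)"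
proof -
  have AB: "\<And>i. A $ i < B $ i" using A B by (meson le_less_trans)
  have sub: "hbox A B \<subseteq> unit_cube" by (rule hbox_subset_unit_cube[OF A(1) B(2)])
  have x: "x \<in> unit_cube"
    using sub A B by (auto simp: hbox_def)
  let ?p = "\<lambda>t. (s x + grad s x \<bullet> (t - x)) + 1/2 * ((t - x) \<bullet> (hessian s x *v (t - x)))"
  have cont: "continuous_on UNIV (\<lambda>t. (t - x) \<bullet> (hessian s x *v (t - x)))"
    by (intro continuous_intros linear_continuous_on linear_linear[THEN iffD2]
        continuous_on_compose2[OF linear_continuous_on[OF matrix_vector_mul_bounded_linear, of UNIV]]) auto
  have "\<bar>box_mean A B s - box_mean A B ?p\<bar> \<le> box_mean A B (\<lambda>t. C * (\<Sum>i\<in>UNIV. \<bar>(t - x) $ i\<bar> ^ 3))"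
  proof (rule abs_box_mean_diff_le[OF s])
    fix t assume "t \<in> hbox A B"
    then have "\<bar>s t - s x - grad s x \<bullet> (t - x) - 1/2 * ((t - x) \<bullet> (hessian s x *v (t - x)))\<bar>
        \<le> C * (\<Sum>i\<in>UNIV. \<bar>(t - x) $ i\<bar> ^ 3)"
      using bound sub x by (auto simp: second_order_bound_def)
    then show "\<bar>s t - ?p t\<bar> \<le> C * (\<Sum>i\<in>UNIV. \<bar>(t - x) $ i\<bar> ^ 3)"
      by (simp add: algebra_simps)
  qed (intro set_integrable_continuous_hbox continuous_intros cont)+
  also have "box_mean A B ?p = box_mean A B (\<lambda>t. s x + grad s x \<bullet> (t - x))
      + box_mean A B (\<lambda>t. 1/2 * ((t - x) \<bullet> (hessian s x *v (t - x))))"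
    by (rule box_mean_add) (intro set_integrable_continuous_hbox continuous_intros cont)+
  also have "box_mean A B (\<lambda>t. C * (\<Sum>i\<in>UNIV. \<bar>(t - x) $ i\<bar> ^ 3))
      \<le> C * (1/4 * (\<Sum>i\<in>UNIV. (x $ i - A $ i) ^ 3 + (B $ i - x $ i) ^ 3))"
    unfolding box_mean_cmult by (rule mult_left_mono[OF box_mean_abs_cubed_le C]) (use A B in auto)
  finally show ?thesis
    by (simp only: box_mean_affine[OF AB] box_mean_cmult box_mean_quadratic_form[OF AB])
       (simp add: grad_def ring_distribs)
qed

section \<open>Cauchy-Schwarz and the variance of a perturbed variable\<close>

lemma (in prob_space) Cauchy_Schwarz_expectation:
  fixes f g :: "'a \<Rightarrow> real"
  assumes [measurable]: "f \<in> borel_measurable M" "g \<in> borel_measurable M"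
    and f: "integrable M (\<lambda>w. (f w)\<^sup>2)" and g: "integrable M (\<lambda>w. (g w)\<^sup>2)"
  shows "integrable M (\<lambda>w. f w * g w)"
    and "\<bar>expectation (\<lambda>w. f w * g w)\<bar> \<le> sqrt (expectation (\<lambda>w. (f w)\<^sup>2) * expectation (\<lambda>w. (g w)\<^sup>2))"
proof -
  show fg: "integrable M (\<lambda>w. f w * g w)"
  proof (rule Bochner_Integration.integrable_bound[OF Bochner_Integration.integrable_add[OF f g]])
    have "norm (u * v) \<le> norm (u\<^sup>2 + v\<^sup>2)" for u v :: real
    proof -
      have "2 * (\<bar>u\<bar> * \<bar>v\<bar>) \<le> u\<^sup>2 + v\<^sup>2"
        using sum_squares_bound[of "\<bar>u\<bar>" "\<bar>v\<bar>"] by simp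
      moreover have "0 \<le> \<bar>u\<bar> * \<bar>v\<bar>" by simp
      ultimately show ?thesis unfolding real_norm_def abs_mult by linarith
    qed
    then show "AE w in M. norm (f w * g w) \<le> norm ((f w)\<^sup>2 + (g w)\<^sup>2)" by simp
  qed simp
  define a b c where "a = expectation (\<lambda>w. (f w)\<^sup>2)" and "b = expectation (\<lambda>w. f w * g w)"
    and "c = expectation (\<lambda>w. (g w)\<^sup>2)"
  have quad: "0 \<le> a + 2 * t * b + t\<^sup>2 * c" for t
  proof -
    have "0 \<le> expectation (\<lambda>w. (f w + t * g w)\<^sup>2)" by simp
    also have "\<dots> = expectation (\<lambda>w. (f w)\<^sup>2 + 2 * t * (f w * g w) + t\<^sup>2 * (g w)\<^sup>2)"
      by (simp add: power2_sum power_mult_distrib algebra_simps)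
    also have "\<dots> = a + 2 * t * b + t\<^sup>2 * c"
      using f g fg by (simp add: a_def b_def c_def)
    finally show ?thesis .
  qed
  have "0 \<le> c" by (simp add: c_def)
  have "b\<^sup>2 \<le> a * c"
  proof (cases "c = 0")
    case True
    have "b = 0"
    proof (rule ccontr)
      assume "b \<noteq> 0"
      \<comment> \<open>A non-constant affine function of \<open>t\<close> takes the value \<open>-1\<close>.\<close>
      with quad[of "- (a + 1) / (2 * b)"] True show False by (simp add: field_simps)
    qed
    with True show ?thesis by simp
  next
    case False
    with \<open>0 \<le> c\<close> have "c > 0" by simp
    \<comment> \<open>The minimiser of the quadratic in \<open>t\<close>.\<close>
    with quad[of "- b / c"] show ?thesis by (simp add: field_simps power2_eq_square)
  qed
  then have "sqrt (b\<^sup>2) \<le> sqrt (a * c)" by (rule real_sqrt_le_mono)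
  then show "\<bar>expectation (\<lambda>w. f w * g w)\<bar> \<le> sqrt (expectation (\<lambda>w. (f w)\<^sup>2) * expectation (\<lambda>w. (g w)\<^sup>2))"
    by (simp add: a_def b_def c_def)
qed

text \<open>
  Only the second moment of the perturbation enters, so the perturbation need not be centred.
\<close>

lemma (in prob_space) variance_add_perturbation:
  fixes L r :: "'a \<Rightarrow> real"
  assumes [measurable]: "L \<in> borel_measurable M" "r \<in> borel_measurable M"
    and L: "integrable M L" "integrable M (\<lambda>w. (L w)\<^sup>2)"
    and r: "integrable M r" "integrable M (\<lambda>w. (r w)\<^sup>2)"
  shows "\<bar>variance (\<lambda>w. L w + r w) - variance L\<bar>
    \<le> 2 * sqrt (variance L * expectation (\<lambda>w. (r w)\<^sup>2)) + expectation (\<lambda>w. (r w)\<^sup>2)"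
proof -
  define l where "l w = L w - expectation L" for w
  define \<rho> where "\<rho> w = r w - expectation r" for w
  have [measurable]: "l \<in> borel_measurable M" "\<rho> \<in> borel_measurable M"
    by (simp_all add: l_def[abs_def] \<rho>_def[abs_def])
  have l: "integrable M l" "integrable M (\<lambda>w. (l w)\<^sup>2)" and \<rho>: "integrable M (\<lambda>w. (\<rho> w)\<^sup>2)"
    using L r by (auto simp: l_def[abs_def] \<rho>_def[abs_def] power2_diff)
  note lr = Cauchy_Schwarz_expectation[of l r, OF _ _ l(2) r(2), simplified]
  have "expectation l = 0" using L by (simp add: l_def[abs_def] prob_space)
  then have l\<rho>: "integrable M (\<lambda>w. l w * \<rho> w)" "expectation (\<lambda>w. l w * \<rho> w) = expectation (\<lambda>w. l w * r w)"
    using lr(1) l by (auto simp: \<rho>_def right_diff_distrib)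
  have "variance (\<lambda>w. L w + r w) = expectation (\<lambda>w. (l w)\<^sup>2 + 2 * (l w * \<rho> w) + (\<rho> w)\<^sup>2)"
    using L r by (simp add: l_def \<rho>_def power2_eq_square algebra_simps)
  also have "\<dots> = variance L + 2 * expectation (\<lambda>w. l w * r w) + variance r"
    using l l\<rho> \<rho> by (simp add: l_def[symmetric] \<rho>_def[symmetric])
  finally have eq: "variance (\<lambda>w. L w + r w) - variance L = 2 * expectation (\<lambda>w. l w * r w) + variance r"
    by simp
  have "variance r \<le> expectation (\<lambda>w. (r w)\<^sup>2)"
    using variance_eq[OF r] by simp
  moreover have "0 \<le> variance r" by simp
  moreover have "\<bar>expectation (\<lambda>w. l w * r w)\<bar> \<le> sqrt (variance L * expectation (\<lambda>w. (r w)\<^sup>2))"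
    using lr(2) by (simp add: l_def)
  ultimately show ?thesis unfolding eq by linarith
qed

section \<open>Calculus on the half-open cube\<close>

lemma unit_cube_axis_slice:
  fixes x :: "real^'n"
  assumes "x \<in> unit_cube"
  shows "{h. x + h *\<^sub>R axis i 1 \<in> unit_cube} = {- x $ i..<1 - x $ i}"
proof -
  have "x + h *\<^sub>R axis i 1 \<in> unit_cube \<longleftrightarrow> h \<in> {- x $ i..<1 - x $ i}" for h
  proof
    assume h: "h \<in> {- x $ i..<1 - x $ i}"
    have "0 \<le> (x + h *\<^sub>R axis i 1) $ k \<and> (x + h *\<^sub>R axis i 1) $ k < 1" for k
      using h assms by (cases "k = i") (auto simp: unit_cube_def axis_def)
    then show "x + h *\<^sub>R axis i 1 \<in> unit_cube" by (simp add: unit_cube_def)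
  next
    assume "x + h *\<^sub>R axis i 1 \<in> unit_cube"
    then have "0 \<le> (x + h *\<^sub>R axis i 1) $ i \<and> (x + h *\<^sub>R axis i 1) $ i < 1"
      unfolding unit_cube_def by blast
    then show "h \<in> {- x $ i..<1 - x $ i}" by simp
  qed
  then show ?thesis by blast
qed

text \<open>
  At a boundary point of the half-open cube the slice along each axis is still a nondegenerate interval
  containing 0, so the one-sided partial derivatives are determined by any derivative within the cube.
\<close>

lemma has_derivative_grad:
  fixes f :: "real^'n \<Rightarrow> real"
  assumes f: "f differentiable (at x within unit_cube)" and x: "x \<in> unit_cube"
  shows "(f has_derivative (\<lambda>h. grad f x \<bullet> h)) (at x within unit_cube)"
proof -
  obtain D where D: "(f has_derivative D) (at x within unit_cube)"
    using f by (auto simp: differentiable_def)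
  have lin: "linear D" using D by (rule has_derivative_linear)
  have part: "partial i f x = D (axis i 1)" for i
  proof -
    let ?S = "{h. x + h *\<^sub>R axis i 1 \<in> unit_cube}"
    have line: "((\<lambda>h. x + h *\<^sub>R axis i 1) has_derivative (\<lambda>h. h *\<^sub>R axis i 1)) (at 0 within ?S)"
      by (auto intro!: derivative_eq_intros)
    have "(f has_derivative D) (at (x + 0 *\<^sub>R axis i 1) within (\<lambda>h. x + h *\<^sub>R axis i 1) ` ?S)"
      using D by (auto intro: has_derivative_subset)
    from has_derivative_in_compose[OF line this]
    have "((\<lambda>h. f (x + h *\<^sub>R axis i 1)) has_vector_derivative D (axis i 1)) (at 0 within ?S)"
      using lin by (simp add: has_vector_derivative_def linear_scale)
    moreover have "at 0 within ?S \<noteq> bot"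
    proof -
      have "0 islimpt {- x $ i..<1 - x $ i}"
      proof (rule connected_imp_perfect)
        have "- x $ i \<in> {- x $ i..<1 - x $ i}" "1/2 - x $ i \<in> {- x $ i..<1 - x $ i}" by auto
        moreover have "- x $ i \<noteq> 1/2 - x $ i" by simp
        ultimately show "{- x $ i..<1 - x $ i} \<noteq> {z}" for z by (metis singletonD)
      qed (use x in \<open>auto simp: unit_cube_def\<close>)
      then show ?thesis by (simp add: unit_cube_axis_slice[OF x] trivial_limit_within)
    qed
    ultimately show ?thesis
      unfolding partial_def by (intro vector_derivative_within)
  qed
  have "D h = grad f x \<bullet> h" for h
  proof -
    have "D h = D (\<Sum>i\<in>UNIV. h $ i *\<^sub>R axis i 1)"
      by (simp add: basis_expansion flip: scalar_mult_eq_scaleR)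
    also have "\<dots> = (\<Sum>i\<in>UNIV. h $ i * D (axis i 1))"
      by (simp add: linear_sum[OF lin] linear_scale[OF lin])
    finally show ?thesis by (simp add: inner_vec_def grad_def part mult.commute)
  qed
  then have "D = (\<lambda>h. grad f x \<bullet> h)" by (rule ext)
  with D show ?thesis by (simp only:)
qed

lemma convex_unit_cube: "convex (unit_cube :: (real^'n) set)"
proof -
  have cube: "unit_cube = (\<Inter>i::'n. {t. 0 \<le> t $ i} \<inter> {t. t $ i < 1})"
    by (auto simp: unit_cube_def)
  have "convex ({t::real^'n. 0 \<le> t $ i} \<inter> {t. t $ i < 1})" for i
    using convex_halfspace_ge[of 0 "axis i 1 :: real^'n"] convex_halfspace_lt[of "axis i 1 :: real^'n" 1]
    by (intro convex_Int) (simp_all add: inner_axis inner_commute)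
  then show ?thesis unfolding cube by (rule convex_INT)
qed

lemma second_order_taylor_upper:
  fixes g g' g'' :: "real \<Rightarrow> real"
  assumes g: "\<And>h. h \<in> {0..1} \<Longrightarrow> (g has_real_derivative g' h) (at h within {0..1})"
    and g': "\<And>h. h \<in> {0..1} \<Longrightarrow> (g' has_real_derivative g'' h) (at h within {0..1})"
    and K: "\<And>h. h \<in> {0..1} \<Longrightarrow> g'' h \<le> K"
  shows "g 1 - g 0 - g' 0 \<le> K / 2"
proof -
  have slope: "g' h - g' 0 \<le> K * h" if h: "h \<in> {0..1}" for h
  proof -
    have "\<exists>u\<in>{0..h}. g' h - g' 0 = g'' u * (h - 0)"
    proof (rule mvt_very_simple)
      fix u assume "0 \<le> u" "u \<le> h"
      then have "(g' has_real_derivative g'' u) (at u within {0..h})"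
        using h by (intro DERIV_subset[OF g']) auto
      then show "(g' has_derivative (\<lambda>d. g'' u * d)) (at u within {0..h})"
        by (simp add: has_field_derivative_def)
    qed (use h in simp)
    then obtain u where "u \<in> {0..h}" "g' h - g' 0 = g'' u * h" by auto
    with h show ?thesis using mult_right_mono[OF K[of u], of h] by auto
  qed
  \<comment> \<open>Subtracting the extremal parabola leaves a function whose slope is nowhere positive.\<close>
  define p where "p h = g h - g' 0 * h - K * h\<^sup>2 / 2" for h
  have "\<exists>u\<in>{0<..<1}. p 1 - p 0 = (g' u - g' 0 - K * u) * (1 - 0)"
  proof (rule mvt_simple)
    fix h :: real assume h: "0 \<le> h" "h \<le> 1"
    have "(p has_real_derivative g' h - g' 0 - K * h) (at h within {0..1})"
      unfolding p_def[abs_def] using h by (auto intro!: derivative_eq_intros g)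
    then show "(p has_derivative (\<lambda>d. (g' h - g' 0 - K * h) * d)) (at h within {0..1})"
      by (simp add: has_field_derivative_def)
  qed simp
  then obtain u where "u \<in> {0<..<1}" "p 1 - p 0 = g' u - g' 0 - K * u" by auto
  with slope[of u] show ?thesis by (auto simp: p_def)
qed

lemma second_order_taylor_bound:
  fixes g g' g'' :: "real \<Rightarrow> real"
  assumes g: "\<And>h. h \<in> {0..1} \<Longrightarrow> (g has_real_derivative g' h) (at h within {0..1})"
    and g': "\<And>h. h \<in> {0..1} \<Longrightarrow> (g' has_real_derivative g'' h) (at h within {0..1})"
    and K: "\<And>h. h \<in> {0..1} \<Longrightarrow> \<bar>g'' h\<bar> \<le> K"
  shows "\<bar>g 1 - g 0 - g' 0\<bar> \<le> K / 2"
proof -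
  have "g 1 - g 0 - g' 0 \<le> K / 2"
    using K by (intro second_order_taylor_upper[OF g g']) (auto simp: abs_le_iff)
  moreover have "(- g 1) - (- g 0) - (- g' 0) \<le> K / 2"
    using K by (intro second_order_taylor_upper[of "\<lambda>h. - g h" "\<lambda>h. - g' h" "\<lambda>h. - g'' h"] DERIV_minus g g')
      (auto simp: abs_le_iff)
  ultimately show ?thesis by linarith
qed

lemma first_order_bound_of_hess_values:
  fixes s :: "real^'n \<Rightarrow> real"
  assumes s: "twice_differentiable_on_cube s" and bdd: "bdd_above (hess_values s)"
  shows "first_order_bound s (hess_norm s / 2)"
  unfolding first_order_bound_def
proof (intro ballI)
  fix t x :: "real^'n" assume t: "t \<in> unit_cube" and x: "x \<in> unit_cube"
  define u where "u = t - x"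
  define y where "y h = x + h *\<^sub>R u" for h
  have y: "y h \<in> unit_cube" if "h \<in> {0..1}" for h
  proof -
    have "y h = (1 - h) *\<^sub>R x + h *\<^sub>R t" by (simp add: y_def u_def algebra_simps)
    then show ?thesis using convexD_alt[OF convex_unit_cube x t, of h] that by auto
  qed
  have dy: "(y has_derivative (\<lambda>d. d *\<^sub>R u)) (at h within {0..1})" for h
  proof -
    have "((\<lambda>h. x + h *\<^sub>R u) has_derivative (\<lambda>d. 0 + d *\<^sub>R u)) (at h within {0..1})"
      by (intro has_derivative_add has_derivative_const has_derivative_scaleR_left has_derivative_ident)
    then show ?thesis by (simp add: y_def[abs_def])
  qed
  have chain: "((\<lambda>h. f (y h)) has_real_derivative grad f (y h) \<bullet> u) (at h within {0..1})"
    if f: "f differentiable_on unit_cube" and h: "h \<in> {0..1}" for f :: "real^'n \<Rightarrow> real" and h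
  proof -
    have "((\<lambda>h. f (y h)) has_derivative (\<lambda>d. grad f (y h) \<bullet> (d *\<^sub>R u))) (at h within {0..1})"
    proof (rule has_derivative_in_compose2[where t = unit_cube and g = f and f = y
          and g' = "\<lambda>z d. grad f z \<bullet> d" and f' = "\<lambda>d. d *\<^sub>R u"])
      fix z :: "real^'n" assume "z \<in> unit_cube"
      then show "(f has_derivative (\<lambda>d. grad f z \<bullet> d)) (at z within unit_cube)"
        using f by (intro has_derivative_grad) (auto simp: differentiable_on_def)
    qed (use h y dy in auto)
    moreover have "(\<lambda>d. grad f (y h) \<bullet> (d *\<^sub>R u)) = (*) (grad f (y h) \<bullet> u)"
      by (simp add: fun_eq_iff)
    ultimately show ?thesis by (simp only: has_field_derivative_def)
  qed
  have ds: "s differentiable_on unit_cube" and dg: "grad s differentiable_on unit_cube"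
    using s by (auto simp: twice_differentiable_on_cube_def)
  have dpart: "partial j s differentiable_on unit_cube" for j
  proof -
    have "(\<lambda>z. grad s z $ j) differentiable_on unit_cube"
      using dg unfolding differentiable_on_def differentiable_def
      by (blast intro: bounded_linear.has_derivative[OF bounded_linear_vec_nth])
    then show ?thesis by (simp add: grad_def)
  qed
  let ?Q = "\<lambda>z. \<Sum>i\<in>UNIV. \<Sum>j\<in>UNIV. hessian s z $ i $ j * u $ i * u $ j"
  have dd: "((\<lambda>h. grad s (y h) \<bullet> u) has_real_derivative ?Q (y h)) (at h within {0..1})"
    if h: "h \<in> {0..1}" for h
  proof -
    have "((\<lambda>h. \<Sum>j\<in>UNIV. partial j s (y h) * u $ j) has_real_derivative
        (\<Sum>j\<in>UNIV. (grad (partial j s) (y h) \<bullet> u) * u $ j)) (at h within {0..1})"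
      by (intro DERIV_sum DERIV_cmult_right chain dpart h)
    moreover have "(\<Sum>j\<in>UNIV. (grad (partial j s) (y h) \<bullet> u) * u $ j) = ?Q (y h)"
      by (subst sum.swap) (simp add: inner_vec_def grad_def hessian_def sum_distrib_right)
    ultimately show ?thesis by (simp add: inner_vec_def grad_def)
  qed
  have Q: "\<bar>?Q z\<bar> \<le> hess_norm s * (norm u)\<^sup>2" if z: "z \<in> unit_cube" for z
  proof (cases "u = 0")
    case False
    define v where "v = u /\<^sub>R norm u"
    have "\<bar>\<Sum>i\<in>UNIV. \<Sum>j\<in>UNIV. hessian s z $ i $ j * v $ i * v $ j\<bar> \<in> hess_values s"
    proof -
      have "norm v \<le> 1" using False by (simp add: v_def)
      then show ?thesis unfolding hess_values_def using z by blast
    qed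
    then have "\<bar>\<Sum>i\<in>UNIV. \<Sum>j\<in>UNIV. hessian s z $ i $ j * v $ i * v $ j\<bar> \<le> hess_norm s"
      unfolding hess_norm_def by (rule cSup_upper[OF _ bdd])
    moreover have "?Q z = (norm u)\<^sup>2 * (\<Sum>i\<in>UNIV. \<Sum>j\<in>UNIV. hessian s z $ i $ j * v $ i * v $ j)"
    proof -
      have u: "u $ i = norm u * v $ i" for i
        using False by (simp add: v_def)
      show ?thesis
        unfolding u sum_distrib_left by (intro sum.cong refl) (simp add: power2_eq_square)
    qed
    then have "\<bar>?Q z\<bar> = \<bar>\<Sum>i\<in>UNIV. \<Sum>j\<in>UNIV. hessian s z $ i $ j * v $ i * v $ j\<bar> * (norm u)\<^sup>2"
      by (simp only: abs_mult abs_power2 mult.commute)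
    ultimately show ?thesis
      by (simp only: mult_right_mono zero_le_power2)
  qed simp
  have "\<bar>s (y 1) - s (y 0) - grad s (y 0) \<bullet> u\<bar> \<le> (hess_norm s * (norm u)\<^sup>2) / 2"
    by (rule second_order_taylor_bound[where g = "\<lambda>h. s (y h)" and g' = "\<lambda>h. grad s (y h) \<bullet> u"
          and g'' = "\<lambda>h. ?Q (y h)"])
      (use chain[OF ds] dd Q y in auto)
  then show "\<bar>s t - s x - grad s x \<bullet> (t - x)\<bar> \<le> hess_norm s / 2 * (norm (t - x))\<^sup>2"
    by (simp add: y_def u_def)
qed

section \<open>Boundedness of the function and of its Hessian\<close>

lemma unit_cube_bounded_by_continuous:
  fixes s p :: "real^'n \<Rightarrow> real"
  assumes p: "continuous_on UNIV p" and le: "\<And>t. t \<in> unit_cube \<Longrightarrow> \<bar>s t\<bar> \<le> p t"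
  shows "\<exists>M. \<forall>t\<in>unit_cube. \<bar>s t\<bar> \<le> M"
proof -
  have "compact (p ` cbox 0 1)"
    by (intro compact_continuous_image compact_cbox continuous_on_subset[OF p]) simp
  then obtain M where "\<And>t. t \<in> cbox 0 1 \<Longrightarrow> \<bar>p t\<bar> \<le> M"
    using compact_imp_bounded bounded_iff by (metis image_eqI real_norm_def)
  moreover have "unit_cube \<subseteq> cbox 0 (1 :: real^'n)"
    by (auto simp: unit_cube_def mem_box_cart less_imp_le)
  ultimately have "\<bar>s t\<bar> \<le> M" if "t \<in> unit_cube" for t
    using le[OF that] that by fastforce
  then show ?thesis by blast
qed

lemma zero_in_unit_cube: "0 \<in> unit_cube"
  by (simp add: unit_cube_def)

lemma first_order_bound_imp_bounded:
  fixes s :: "real^'n \<Rightarrow> real"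
  assumes s: "first_order_bound s C"
  shows "\<exists>M. \<forall>t\<in>unit_cube. \<bar>s t\<bar> \<le> M"
proof (rule unit_cube_bounded_by_continuous)
  fix t :: "real^'n" assume "t \<in> unit_cube"
  then have "\<bar>s t - s 0 - grad s 0 \<bullet> (t - 0)\<bar> \<le> C * (norm (t - 0))\<^sup>2"
    using s zero_in_unit_cube unfolding first_order_bound_def by blast
  then show "\<bar>s t\<bar> \<le> \<bar>s 0 + grad s 0 \<bullet> t\<bar> + C * (norm t)\<^sup>2"
    unfolding diff_zero by linarith
qed (intro continuous_intros)+

lemma second_order_bound_imp_bounded:
  fixes s :: "real^'n \<Rightarrow> real"
  assumes s: "second_order_bound s C"
  shows "\<exists>M. \<forall>t\<in>unit_cube. \<bar>s t\<bar> \<le> M"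
proof (rule unit_cube_bounded_by_continuous)
  fix t :: "real^'n" assume "t \<in> unit_cube"
  then have "\<bar>s t - s 0 - grad s 0 \<bullet> (t - 0) - 1/2 * ((t - 0) \<bullet> (hessian s 0 *v (t - 0)))\<bar>
      \<le> C * (\<Sum>i\<in>UNIV. \<bar>(t - 0) $ i\<bar> ^ 3)"
    using s zero_in_unit_cube unfolding second_order_bound_def by blast
  then show "\<bar>s t\<bar> \<le> \<bar>s 0 + grad s 0 \<bullet> t + 1/2 * (t \<bullet> (hessian s 0 *v t))\<bar> + C * (\<Sum>i\<in>UNIV. \<bar>t $ i\<bar> ^ 3)"
    unfolding diff_zero by linarith
qed (intro continuous_intros linear_continuous_on matrix_vector_mul_bounded_linear)+

text \<open>
  The second difference cancels the value and the gradient of \<open>s\<close> at \<open>y\<close>, so no bound on the gradient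
  is needed.  The constant 10 is \<open>8 + 2 * 1\<close>, from the cubic remainders at \<open>2u\<close> and \<open>u\<close>.
\<close>

lemma second_difference_bound:
  fixes s :: "real^'n \<Rightarrow> real"
  assumes s: "second_order_bound s C" and M: "\<And>t. t \<in> unit_cube \<Longrightarrow> \<bar>s t\<bar> \<le> M"
    and y: "y \<in> unit_cube" "y + u \<in> unit_cube" "y + 2 *\<^sub>R u \<in> unit_cube"
  shows "\<bar>u \<bullet> (hessian s y *v u)\<bar> \<le> 4 * M + 10 * C * (\<Sum>i\<in>UNIV. \<bar>u $ i\<bar> ^ 3)"
proof -
  let ?q = "u \<bullet> (hessian s y *v u)" and ?e = "C * (\<Sum>i\<in>UNIV. \<bar>u $ i\<bar> ^ 3)"
  have R: "\<bar>s (y + v) - s y - grad s y \<bullet> v - 1/2 * (v \<bullet> (hessian s y *v v))\<bar>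
      \<le> C * (\<Sum>i\<in>UNIV. \<bar>v $ i\<bar> ^ 3)" if "y + v \<in> unit_cube" for v
    using s that y(1) unfolding second_order_bound_def by (metis add_diff_cancel_left')
  have 1: "\<bar>s (y + u) - s y - grad s y \<bullet> u - 1/2 * ?q\<bar> \<le> ?e"
    using R[of u] y by simp
  have "(\<Sum>i\<in>UNIV. \<bar>(2 *\<^sub>R u) $ i\<bar> ^ 3) = 8 * (\<Sum>i\<in>UNIV. \<bar>u $ i\<bar> ^ 3)"
    by (simp add: abs_mult power_mult_distrib sum_distrib_left)
  moreover have "(2 *\<^sub>R u) \<bullet> (hessian s y *v (2 *\<^sub>R u)) = 4 * ?q"
    by (simp add: matrix_vector_mult_scaleR)
  ultimately have 2: "\<bar>s (y + 2 *\<^sub>R u) - s y - 2 * (grad s y \<bullet> u) - 2 * ?q\<bar> \<le> 8 * ?e"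
    using R[of "2 *\<^sub>R u"] y by (simp add: mult_ac)
  show ?thesis
    using 1 2 M[OF y(1)] M[OF y(2)] M[OF y(3)] by linarith
qed

lemma quadratic_form_parallelogram:
  fixes H :: "real^'n^'n"
  shows "(p - q) \<bullet> (H *v (p - q)) = 2 * (p \<bullet> (H *v p)) + 2 * (q \<bullet> (H *v q)) - (p + q) \<bullet> (H *v (p + q))"
  by (simp add: matrix_vector_mult_diff_distrib matrix_vector_right_distrib inner_diff_left
      inner_diff_right inner_add_left inner_add_right)

lemma bdd_above_hess_values:
  fixes s :: "real^'n \<Rightarrow> real"
  assumes s: "second_order_bound s C" and C: "0 \<le> C"
  shows "bdd_above (hess_values s)"
proof -
  obtain M where M: "\<And>t. t \<in> unit_cube \<Longrightarrow> \<bar>s t\<bar> \<le> M"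
    using second_order_bound_imp_bounded[OF s] by blast
  define K where "K = 4 * M + 10 * C * (\<Sum>i\<in>(UNIV::'n set). 1)"
  have "\<bar>\<Sum>i\<in>UNIV. \<Sum>j\<in>UNIV. hessian s y $ i $ j * v $ i * v $ j\<bar> \<le> 16 * (5 * K)"
    if v: "norm v \<le> 1" and y: "y \<in> unit_cube" for v y :: "real^'n"
  proof -
    \<comment> \<open>Moving \<open>y\<close> along an axis in the direction \<open>\<sigma> i\<close> by at most 1/2 stays in the cube, so a step of at
      most 1/4 may be doubled.  The face at 1 is missing, but it is only approached from \<open>y $ i < 1/2\<close>.\<close>
    define \<sigma> where "\<sigma> i = (if y $ i < 1/2 then 1 else - 1 :: real)" for i
    let ?Q = "\<lambda>u. u \<bullet> (hessian s y *v u)"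
    have inward: "\<bar>?Q u\<bar> \<le> K" if u: "\<And>i. 0 \<le> \<sigma> i * u $ i" "\<And>i. \<sigma> i * u $ i \<le> 1/4 * \<bar>v $ i\<bar>" for u
    proof -
      have vi: "\<bar>v $ i\<bar> \<le> 1" for i
        using component_le_norm_cart[of v i] v by linarith
      have ui: "if y $ i < 1/2 then 0 \<le> u $ i \<and> u $ i \<le> 1/4 else - (1/4) \<le> u $ i \<and> u $ i \<le> 0" for i
        using u(1)[of i] u(2)[of i] vi[of i] by (auto simp: \<sigma>_def)
      have yi: "0 \<le> y $ i \<and> y $ i < 1" for i
        using y by (simp add: unit_cube_def)
      have "0 \<le> y $ i + u $ i \<and> y $ i + u $ i < 1 \<and> 0 \<le> y $ i + 2 * u $ i \<and> y $ i + 2 * u $ i < 1" for i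
        using ui[of i] yi[of i] by (auto split: if_splits)
      then have "y + u \<in> unit_cube" "y + 2 *\<^sub>R u \<in> unit_cube"
        by (auto simp: unit_cube_def)
      then have "\<bar>?Q u\<bar> \<le> 4 * M + 10 * C * (\<Sum>i\<in>UNIV. \<bar>u $ i\<bar> ^ 3)"
        by (intro second_difference_bound[OF s M y])
      moreover have "\<bar>u $ i\<bar> \<le> 1" for i
        using ui[of i] by (auto split: if_splits)
      then have "4 * M + 10 * C * (\<Sum>i\<in>UNIV. \<bar>u $ i\<bar> ^ 3) \<le> K"
        unfolding K_def using C by (intro add_left_mono mult_left_mono sum_mono power_le_one) auto
      ultimately show ?thesis by linarith
    qed
    \<comment> \<open>Up to the factor 1/4, \<open>p\<close> and \<open>q\<close> are the parts of \<open>v\<close> in the inward orthant and in its opposite,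
      the latter reflected.\<close>
    define p where "p = (\<chi> i. \<sigma> i * max 0 (\<sigma> i * v $ i) / 4)"
    define q where "q = (\<chi> i. \<sigma> i * max 0 (- (\<sigma> i * v $ i)) / 4)"
    have "\<bar>?Q p\<bar> \<le> K" "\<bar>?Q q\<bar> \<le> K" "\<bar>?Q (p + q)\<bar> \<le> K"
      by (rule inward; simp add: p_def q_def \<sigma>_def max_def)+
    moreover have "p - q = (1/4) *\<^sub>R v"
      by (simp add: vec_eq_iff p_def q_def \<sigma>_def max_def)
    then have "?Q (p - q) = 1/16 * ?Q v"
      by (simp add: matrix_vector_mult_scaleR)
    moreover have "?Q v = (\<Sum>i\<in>UNIV. \<Sum>j\<in>UNIV. hessian s y $ i $ j * v $ i * v $ j)"
      by (simp add: inner_vec_def matrix_vector_mult_def sum_distrib_left mult_ac)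
    ultimately show ?thesis
      using quadratic_form_parallelogram[of p q "hessian s y"] by linarith
  qed
  then show ?thesis
    unfolding bdd_above_def hess_values_def by blast
qed

section \<open>Bounded measurable functions\<close>

text \<open>
  Bounded measurable functions are integrable with respect to a finite measure, and unlike integrable
  ones they are closed under products; all random variables below are of this kind.
\<close>

definition bounded_measurable :: "'a measure \<Rightarrow> ('a \<Rightarrow> real) \<Rightarrow> bool"
  where "bounded_measurable M f \<longleftrightarrow> f \<in> borel_measurable M \<and> (\<exists>c. \<forall>w\<in>space M. \<bar>f w\<bar> \<le> c)"

named_theorems bounded_measurable_intros

lemma bounded_measurableI:
  assumes "f \<in> borel_measurable M" "\<And>w. w \<in> space M \<Longrightarrow> \<bar>f w\<bar> \<le> c"
  shows "bounded_measurable M f"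
  using assms by (auto simp: bounded_measurable_def)

lemma bounded_measurable_const [bounded_measurable_intros]: "bounded_measurable M (\<lambda>_. c)"
  by (rule bounded_measurableI[of _ _ "\<bar>c\<bar>"]) auto

lemma bounded_measurable_add [bounded_measurable_intros]:
  assumes "bounded_measurable M f" "bounded_measurable M g"
  shows "bounded_measurable M (\<lambda>w. f w + g w)"
proof -
  obtain c d where c: "\<forall>w\<in>space M. \<bar>f w\<bar> \<le> c" and d: "\<forall>w\<in>space M. \<bar>g w\<bar> \<le> d"
    using assms by (auto simp: bounded_measurable_def)
  show ?thesis
  proof (rule bounded_measurableI)
    show "\<bar>f w + g w\<bar> \<le> c + d" if "w \<in> space M" for w
      using c d that by (meson abs_triangle_ineq add_mono order_trans)
  qed (use assms in \<open>auto simp: bounded_measurable_def\<close>)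
qed

lemma bounded_measurable_mult [bounded_measurable_intros]:
  assumes "bounded_measurable M f" "bounded_measurable M g"
  shows "bounded_measurable M (\<lambda>w. f w * g w)"
proof -
  obtain c d where c: "\<forall>w\<in>space M. \<bar>f w\<bar> \<le> c" and d: "\<forall>w\<in>space M. \<bar>g w\<bar> \<le> d"
    using assms by (auto simp: bounded_measurable_def)
  show ?thesis
  proof (rule bounded_measurableI)
    show "\<bar>f w * g w\<bar> \<le> c * d" if "w \<in> space M" for w
      unfolding abs_mult using c d that by (intro mult_mono) (auto intro: order_trans[OF abs_ge_zero])
  qed (use assms in \<open>auto simp: bounded_measurable_def\<close>)
qed

lemma bounded_measurable_diff [bounded_measurable_intros]:
  assumes "bounded_measurable M f" "bounded_measurable M g"
  shows "bounded_measurable M (\<lambda>w. f w - g w)"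
  using bounded_measurable_add[OF assms(1) bounded_measurable_mult[OF bounded_measurable_const assms(2), of "- 1"]]
  by simp

lemma bounded_measurable_power [bounded_measurable_intros]:
  assumes "bounded_measurable M f"
  shows "bounded_measurable M (\<lambda>w. f w ^ k)"
  by (induction k) (simp_all add: bounded_measurable_const bounded_measurable_mult assms)

lemma bounded_measurable_sum [bounded_measurable_intros]:
  assumes "\<And>k. k \<in> S \<Longrightarrow> bounded_measurable M (f k)"
  shows "bounded_measurable M (\<lambda>w. \<Sum>k\<in>S. f k w)"
  using assms
  by (induction S rule: infinite_finite_induct)
    (simp_all add: bounded_measurable_const bounded_measurable_add)

lemma (in finite_measure) integrable_bounded_measurable:
  assumes "bounded_measurable M f" shows "integrable M f"
proof -
  obtain c where "\<forall>w\<in>space M. \<bar>f w\<bar> \<le> c" and f: "f \<in> borel_measurable M"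
    using assms by (auto simp: bounded_measurable_def)
  then show ?thesis by (intro integrable_const_bound[OF _ f, of c]) simp
qed

section \<open>The cell of a random partition containing a given point\<close>

lemma cell_eq_hbox:
  fixes U :: "(real^'n) set set"
  assumes U: "rect_partition U" and x: "x \<in> unit_cube"
  defines "A \<equiv> lower_corner (cell U x)" and "B \<equiv> upper_corner (cell U x)"
  shows "cell U x = hbox A B"
    and "0 \<le> A $ i" "A $ i \<le> x $ i" "x $ i < B $ i" "B $ i \<le> 1"
proof -
  have part: "partition_on unit_cube U" using U by (simp add: rect_partition_def)
  then obtain I where I: "I \<in> U" "x \<in> I" using x by (auto simp: partition_on_def)
  have "cell U x = I" unfolding cell_def
  proof (rule the_equality)
    fix J assume "J \<in> U \<and> x \<in> J"
    with I part show "J = I" unfolding partition_on_def disjoint_def by blast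
  qed (use I in simp)
  moreover have "is_cell I" using U I by (simp add: rect_partition_def)
  ultimately obtain A' B' where AB: "\<forall>i. 0 \<le> A' $ i \<and> A' $ i < B' $ i \<and> B' $ i \<le> 1"
    and c: "cell U x = hbox A' B'" by (auto simp: is_cell_def)
  have "\<forall>i. A' $ i < B' $ i" using AB by blast
  from corner_hbox[OF this] have AB': "A = A'" "B = B'" by (simp_all add: A_def B_def c)
  then show "cell U x = hbox A B" using c by simp
  have "x \<in> hbox A' B'" using I \<open>cell U x = I\<close> c by simp
  then show "0 \<le> A $ i" "A $ i \<le> x $ i" "x $ i < B $ i" "B $ i \<le> 1"
    unfolding AB' using AB by (auto simp: hbox_def)
qed

lemma unit_cube_borel: "unit_cube \<in> sets borel"
  by (simp add: unit_cube_eq_hbox)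

lemma borel_measurable_vec_nth [measurable]: "(\<lambda>v::real^'n. v $ i) \<in> borel_measurable borel"
  by (intro borel_measurable_continuous_onI continuous_intros)

lemma abs_sq_bounds:
  fixes m e r :: real
  assumes "\<bar>e\<bar> \<le> r"
  shows "m\<^sup>2 - 2 * \<bar>m\<bar> * r \<le> (m + e)\<^sup>2" and "(m + e)\<^sup>2 \<le> (\<bar>m\<bar> + r)\<^sup>2"
    and "\<bar>(m + e)\<^sup>2 - m\<^sup>2\<bar> \<le> 2 * \<bar>r * m\<bar> + r\<^sup>2"
proof -
  have me: "\<bar>m * e\<bar> \<le> \<bar>m\<bar> * r"
    using assms by (simp add: abs_mult mult_left_mono)
  have e2: "0 \<le> e\<^sup>2" "e\<^sup>2 \<le> r\<^sup>2"
    using assms by (simp_all add: abs_le_square_iff[symmetric])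
  have sq: "(m + e)\<^sup>2 = m\<^sup>2 + 2 * (m * e) + e\<^sup>2" by (simp add: power2_sum)
  have "r * \<bar>m\<bar> = \<bar>r * m\<bar>" using assms by (simp add: abs_mult)
  with me e2 show "\<bar>(m + e)\<^sup>2 - m\<^sup>2\<bar> \<le> 2 * \<bar>r * m\<bar> + r\<^sup>2"
    unfolding sq by (simp only: mult.commute[of "\<bar>m\<bar>"])
  show "m\<^sup>2 - 2 * \<bar>m\<bar> * r \<le> (m + e)\<^sup>2" unfolding sq using me e2 by linarith
  have "\<bar>m + e\<bar> \<le> \<bar>\<bar>m\<bar> + r\<bar>" using assms by linarith
  then show "(m + e)\<^sup>2 \<le> (\<bar>m\<bar> + r)\<^sup>2" by (simp only: abs_le_square_iff)
qed

text \<open>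
  A fixed evaluation point \<open>x\<close>, with \<open>s\<close> bounded on the cube; both Taylor bounds imply this boundedness.
\<close>

locale random_cell_at =
  fixes \<U> :: "(real^'n) set set measure" and P :: "'w measure" and X :: "'w \<Rightarrow> real^'n"
    and s :: "real^'n \<Rightarrow> real" and M :: real and x :: "real^'n"
  assumes random: "random_partition \<U>" and X: "uniform_on_cube P X"
    and s_diff: "s differentiable_on unit_cube"
    and s_bound: "\<And>t. t \<in> unit_cube \<Longrightarrow> \<bar>s t\<bar> \<le> M"
    and x: "x \<in> unit_cube"
begin

sublocale prob_space \<U>
  using random by (simp add: random_partition_def)

abbreviation lo where "lo U \<equiv> lower_corner (cell U x)"
abbreviation up where "up U \<equiv> upper_corner (cell U x)"
abbreviation a where "a \<equiv> a_len x"
abbreviation b where "b \<equiv> b_len x"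
abbreviation m where "m U \<equiv> cell_mean P X s U x"

lemma partition: "U \<in> space \<U> \<Longrightarrow> rect_partition U"
  using random by (simp add: random_partition_def)

lemmas cell_box = cell_eq_hbox[OF partition x]

lemma measurable_corners [measurable]:
  "lo \<in> borel_measurable \<U>" "up \<in> borel_measurable \<U>"
  using random x by (simp_all add: random_partition_def)

lemma measurable_corner_nth [measurable]:
  "(\<lambda>U. lo U $ i) \<in> borel_measurable \<U>" "(\<lambda>U. up U $ i) \<in> borel_measurable \<U>"
  by (rule measurable_compose[OF _ borel_measurable_vec_nth]; rule measurable_corners)+

lemma measurable_len [measurable]:
  "(\<lambda>U. a U i) \<in> borel_measurable \<U>" "(\<lambda>U. b U i) \<in> borel_measurable \<U>"
  unfolding a_len_def b_len_def by measurable

lemma len_bounds: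
  assumes "U \<in> space \<U>"
  shows "0 \<le> a U i" "a U i \<le> 1" "0 \<le> b U i" "b U i \<le> 1"
proof -
  have "0 \<le> x $ i" "x $ i < 1" using x by (simp_all add: unit_cube_def)
  with cell_box(2-5)[OF assms, of i]
  show "0 \<le> a U i" "a U i \<le> 1" "0 \<le> b U i" "b U i \<le> 1"
    unfolding a_len_def b_len_def by linarith+
qed

lemma measurable_s: "(\<lambda>t. indicator unit_cube t * s t) \<in> borel_measurable borel"
  using borel_measurable_continuous_on_indicator[OF unit_cube_borel differentiable_imp_continuous_on[OF s_diff]]
  by simp

lemma set_integrable_s:
  assumes "hbox A B \<subseteq> unit_cube"
  shows "set_integrable lborel (hbox A B) s"
proof (rule set_integrable_bound[OF set_integrable_hbox_const[of A B M]])
  have "(\<lambda>t. indicator (hbox A B) t * (indicator unit_cube t * s t)) \<in> borel_measurable lborel"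
    using measurable_s by simp
  moreover have "(\<lambda>t. indicator (hbox A B) t * (indicator unit_cube t * s t)) = (\<lambda>t. indicator (hbox A B) t *\<^sub>R s t)"
    using assms by (intro ext) (auto split: split_indicator)
  ultimately show "set_borel_measurable lborel (hbox A B) s"
    unfolding set_borel_measurable_def by simp
  show "AE t in lborel. t \<in> hbox A B \<longrightarrow> norm (s t) \<le> norm M"
    using assms s_bound by (intro AE_I2) force
qed

lemma cell_mean_eq:
  assumes U: "U \<in> space \<U>"
  shows "m U = box_mean (lo U) (up U) s"
proof -
  define A B where "A = lo U" and "B = up U"
  have cell: "cell U x = hbox A B"
    unfolding A_def B_def by (rule cell_box(1)[OF U])
  have sub: "hbox A B \<subseteq> unit_cube"
    unfolding A_def B_def by (rule hbox_subset_unit_cube) (use cell_box(2-5)[OF U] in auto)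
  have "set_borel_measurable lborel (hbox A B) s"
    using set_integrable_s[OF sub] by (simp add: set_integrable_def set_borel_measurable_def)
  then have "m U = box_mean A B s"
    unfolding cell_mean_def cell box_mean_def by (intro cond_mean_eq_average[OF X hbox_borel sub])
  then show ?thesis by (simp only: A_def B_def)
qed

text \<open>
  The cell enters only through its corners, which are measurable; the integral of \<open>s\<close> over the cell is
  then a measurable function of the partition as a parametrised integral.
\<close>

lemma measurable_cell_mean: "m \<in> borel_measurable \<U>"
proof -
  \<comment> \<open>Off the cube \<open>s\<close> is arbitrary and has to be cut off to be measurable.\<close>
  let ?s = "\<lambda>t. indicator unit_cube t * s t"
  note [measurable] = measurable_s
  have [measurable]: "(\<lambda>U. \<integral>t. (if \<forall>i. lo U $ i \<le> t $ i \<and> t $ i < up U $ i then ?s t else 0) \<partial>lborel) \<in> borel_measurable \<U>"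
    by (rule lborel.borel_measurable_lebesgue_integral) measurable
  have "(\<lambda>U. (\<integral>t. (if \<forall>i. lo U $ i \<le> t $ i \<and> t $ i < up U $ i then ?s t else 0) \<partial>lborel)
      / (\<Prod>i\<in>UNIV. up U $ i - lo U $ i)) \<in> borel_measurable \<U>"
    by measurable
  moreover have "m U = (\<integral>t. (if \<forall>i. lo U $ i \<le> t $ i \<and> t $ i < up U $ i then ?s t else 0) \<partial>lborel)
      / (\<Prod>i\<in>UNIV. up U $ i - lo U $ i)" if U: "U \<in> space \<U>" for U
  proof -
    have sub: "hbox (lo U) (up U) \<subseteq> unit_cube"
      by (rule hbox_subset_unit_cube) (use cell_box(2-5)[OF U] in auto)
    have "(LINT t:hbox (lo U) (up U)|lborel. s t)
        = (\<integral>t. (if \<forall>i. lo U $ i \<le> t $ i \<and> t $ i < up U $ i then ?s t else 0) \<partial>lborel)"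
      unfolding set_lebesgue_integral_def
      by (rule Bochner_Integration.integral_cong) (use sub in \<open>auto simp: indicator_def hbox_def\<close>)
    moreover have "measure lborel (hbox (lo U) (up U)) = (\<Prod>i\<in>UNIV. up U $ i - lo U $ i)"
      using cell_box(2-5)[OF U] by (intro measure_hbox) (meson less_imp_le order_trans)
    ultimately show ?thesis by (simp add: cell_mean_eq[OF U] box_mean_def)
  qed
  ultimately show ?thesis by (subst measurable_cong)
qed

lemma bounded_measurable_len [bounded_measurable_intros]:
  "bounded_measurable \<U> (\<lambda>U. a U i)" "bounded_measurable \<U> (\<lambda>U. b U i)"
  by (rule bounded_measurableI[of _ _ 1]; simp add: len_bounds measurable_len)+

lemma bounded_measurable_cell_mean [bounded_measurable_intros]: "bounded_measurable \<U> m"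
proof (rule bounded_measurableI[OF measurable_cell_mean])
  fix U assume U: "U \<in> space \<U>"
  have AB: "lo U $ i < up U $ i" for i
    using cell_box(3,4)[OF U, of i] by linarith
  have sub: "hbox (lo U) (up U) \<subseteq> unit_cube"
    by (rule hbox_subset_unit_cube) (use cell_box(2-5)[OF U] in auto)
  have "\<bar>box_mean (lo U) (up U) s - box_mean (lo U) (up U) (\<lambda>_. 0)\<bar> \<le> box_mean (lo U) (up U) (\<lambda>_. M)"
    by (rule abs_box_mean_diff_le) (use sub s_bound set_integrable_s[OF sub] in auto)
  then show "\<bar>m U\<bar> \<le> M"
    by (simp add: cell_mean_eq[OF U] box_mean_const[OF AB])
qed

text \<open>
  The mean over the cell of the linear part of the Taylor polynomial of \<open>s\<close> at \<open>x\<close>.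
\<close>

definition slope_term where
  "slope_term U = 1/2 * (\<Sum>i\<in>UNIV. partial i s x * (b U i - a U i))"

text \<open>
  The mean over the cell of the quadratic part of the Taylor polynomial of \<open>s\<close> at \<open>x\<close>.
\<close>

definition curvature_term where
  "curvature_term U = 1/6 * (\<Sum>i\<in>UNIV. hessian s x $ i $ i * ((a U i)\<^sup>2 + (b U i)\<^sup>2 - a U i * b U i))
    + 1/8 * (\<Sum>i\<in>UNIV. \<Sum>j\<in>UNIV - {i}. hessian s x $ i $ j * ((b U i - a U i) * (b U j - a U j)))"

lemma bounded_measurable_slope [bounded_measurable_intros]: "bounded_measurable \<U> slope_term"
  unfolding slope_term_def[abs_def] by (intro bounded_measurable_intros)

lemma bounded_measurable_curvature [bounded_measurable_intros]: "bounded_measurable \<U> curvature_term"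
  unfolding curvature_term_def[abs_def] by (intro bounded_measurable_intros)

lemmas integrable_intros = integrable_bounded_measurable bounded_measurable_intros

lemma expectation_sum_mult:
  assumes "\<And>i. bounded_measurable \<U> (f i)"
  shows "expectation (\<lambda>U. \<Sum>i\<in>S. c i * f i U) = (\<Sum>i\<in>S. c i * expectation (f i))"
  using assms by (simp add: integrable_bounded_measurable)

lemma expectation_slope: "expectation slope_term = M1 \<U> s x"
  unfolding slope_term_def[abs_def] M1_def integral_mult_right_zero
  by (subst expectation_sum_mult) (intro bounded_measurable_intros refl)+

lemma expectation_curvature: "expectation curvature_term = M2 \<U> s x"
proof -
  have "expectation curvature_term
    = expectation (\<lambda>U. 1/6 * (\<Sum>i\<in>UNIV. hessian s x $ i $ i * ((a U i)\<^sup>2 + (b U i)\<^sup>2 - a U i * b U i)))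
    + expectation (\<lambda>U. 1/8 * (\<Sum>i\<in>UNIV. \<Sum>j\<in>UNIV - {i}. hessian s x $ i $ j * ((b U i - a U i) * (b U j - a U j))))"
    unfolding curvature_term_def[abs_def]
    by (rule Bochner_Integration.integral_add) (intro integrable_intros)+
  also have "expectation (\<lambda>U. 1/6 * (\<Sum>i\<in>UNIV. hessian s x $ i $ i * ((a U i)\<^sup>2 + (b U i)\<^sup>2 - a U i * b U i)))
    = 1/6 * (\<Sum>i\<in>UNIV. hessian s x $ i $ i * expectation (\<lambda>U. (a U i)\<^sup>2 + (b U i)\<^sup>2 - a U i * b U i))"
    unfolding integral_mult_right_zero
    by (subst expectation_sum_mult) (intro bounded_measurable_intros refl)+
  also have "expectation (\<lambda>U. 1/8 * (\<Sum>i\<in>UNIV. \<Sum>j\<in>UNIV - {i}. hessian s x $ i $ j * ((b U i - a U i) * (b U j - a U j))))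
    = 1/8 * (\<Sum>i\<in>UNIV. expectation (\<lambda>U. \<Sum>j\<in>UNIV - {i}. hessian s x $ i $ j * ((b U i - a U i) * (b U j - a U j))))"
    unfolding integral_mult_right_zero
    by (subst Bochner_Integration.integral_sum) (intro integrable_intros refl)+
  also have "(\<lambda>i. expectation (\<lambda>U. \<Sum>j\<in>UNIV - {i}. hessian s x $ i $ j * ((b U i - a U i) * (b U j - a U j))))
    = (\<lambda>i. \<Sum>j\<in>UNIV - {i}. hessian s x $ i $ j * expectation (\<lambda>U. (b U i - a U i) * (b U j - a U j)))"
    by (rule ext, rule expectation_sum_mult) (intro bounded_measurable_intros)
  finally show ?thesis by (simp only: M2_def)
qed

lemma expectation_slope_sq: "expectation (\<lambda>U. (slope_term U)\<^sup>2) = N2 \<U> s x"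
proof -
  let ?p = "\<lambda>i. partial i s x" and ?d = "\<lambda>U i. b U i - a U i"
  let ?E = "\<lambda>i j. expectation (\<lambda>U. ?d U i * ?d U j)"
  have "(slope_term U)\<^sup>2 = 1/4 * (\<Sum>i\<in>UNIV. \<Sum>j\<in>UNIV. (?p i * ?p j) * (?d U i * ?d U j))" for U
    by (simp add: slope_term_def power2_eq_square sum_product mult_ac)
  then have "expectation (\<lambda>U. (slope_term U)\<^sup>2)
      = 1/4 * expectation (\<lambda>U. \<Sum>i\<in>UNIV. \<Sum>j\<in>UNIV. (?p i * ?p j) * (?d U i * ?d U j))"
    by (simp only: integral_mult_right_zero)
  also have "expectation (\<lambda>U. \<Sum>i\<in>UNIV. \<Sum>j\<in>UNIV. (?p i * ?p j) * (?d U i * ?d U j))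
      = (\<Sum>i\<in>UNIV. expectation (\<lambda>U. \<Sum>j\<in>UNIV. (?p i * ?p j) * (?d U i * ?d U j)))"
    by (rule Bochner_Integration.integral_sum) (intro integrable_intros)
  also have "(\<lambda>i. expectation (\<lambda>U. \<Sum>j\<in>UNIV. (?p i * ?p j) * (?d U i * ?d U j)))
      = (\<lambda>i. \<Sum>j\<in>UNIV. (?p i * ?p j) * ?E i j)"
    by (rule ext, rule expectation_sum_mult) (intro bounded_measurable_intros)
  also have "(\<Sum>i\<in>UNIV. \<Sum>j\<in>UNIV. (?p i * ?p j) * ?E i j)
      = (\<Sum>i\<in>UNIV. (?p i)\<^sup>2 * ?E i i + (\<Sum>j\<in>UNIV - {i}. (?p i * ?p j) * ?E i j))"
    by (intro sum.cong refl, subst sum.remove) (simp_all add: power2_eq_square)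
  also have "(\<lambda>i. ?E i i) = (\<lambda>i. expectation (\<lambda>U. (a U i)\<^sup>2 + (b U i)\<^sup>2 - 2 * a U i * b U i))"
    by (simp add: power2_eq_square algebra_simps)
  finally show ?thesis
    unfolding N2_def by (simp only: sum.distrib ring_distribs)
qed

lemma cell_mean_first_order:
  assumes bound: "first_order_bound s C" and U: "U \<in> space \<U>"
  shows "\<bar>m U - s x - slope_term U\<bar> \<le> C / 3 * (\<Sum>i\<in>UNIV. (a U i)\<^sup>2 + (b U i)\<^sup>2 - a U i * b U i)"
proof -
  have sub: "hbox (lo U) (up U) \<subseteq> unit_cube"
    by (rule hbox_subset_unit_cube) (use cell_box(2-5)[OF U] in auto)
  show ?thesis
    using box_mean_first_order_remainder[OF cell_box(2-5)[OF U] set_integrable_s[OF sub] bound]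
    by (simp add: cell_mean_eq[OF U] slope_term_def a_len_def b_len_def diff_diff_add)
qed

lemma cell_mean_second_order:
  assumes bound: "second_order_bound s C" "0 \<le> C" and U: "U \<in> space \<U>"
  shows "\<bar>m U - s x - (slope_term U + curvature_term U)\<bar> \<le> C / 4 * (\<Sum>i\<in>UNIV. (a U i) ^ 3 + (b U i) ^ 3)"
proof -
  have sub: "hbox (lo U) (up U) \<subseteq> unit_cube"
    by (rule hbox_subset_unit_cube) (use cell_box(2-5)[OF U] in auto)
  show ?thesis
    using box_mean_second_order_remainder[OF cell_box(2-5)[OF U] set_integrable_s[OF sub] bound]
    by (simp only: cell_mean_eq[OF U] slope_term_def curvature_term_def a_len_def b_len_def diff_diff_add add.assoc)
qed

text \<open>
  Here \<open>t\<close> is a random approximation to the deviation of the cell mean from \<open>s x\<close>, with error at most \<open>e\<close>.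
\<close>

lemma bias_deviation:
  assumes t: "bounded_measurable \<U> t" and e: "bounded_measurable \<U> e"
    and le: "\<And>U. U \<in> space \<U> \<Longrightarrow> \<bar>m U - s x - t U\<bar> \<le> e U"
  shows "\<bar>expectation m - s x - expectation t\<bar> \<le> expectation e"
proof -
  note bm = bounded_measurable_cell_mean bounded_measurable_const t e
  have "expectation m - s x - expectation t = expectation (\<lambda>U. m U - s x - t U)"
    using bm[THEN integrable_bounded_measurable] by (simp add: prob_space)
  also have "\<bar>\<dots>\<bar> \<le> expectation e"
  proof (rule order_trans[OF integral_abs_bound integral_mono])
    show "integrable \<U> (\<lambda>U. \<bar>m U - s x - t U\<bar>)"
      by (rule integrable_abs) (intro integrable_intros t e)
  qed (use le in \<open>auto intro: integrable_bounded_measurable[OF e]\<close>)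
  finally show ?thesis .
qed

lemma expectation_first_order_error:
  "expectation (\<lambda>U. C / 3 * (\<Sum>i\<in>UNIV. (a U i)\<^sup>2 + (b U i)\<^sup>2 - a U i * b U i)) = R2 \<U> C x"
  unfolding R2_def integral_mult_right_zero
  by (subst Bochner_Integration.integral_sum) (intro integrable_intros refl)+

lemma expectation_second_order_error:
  "expectation (\<lambda>U. C / 4 * (\<Sum>i\<in>UNIV. (a U i) ^ 3 + (b U i) ^ 3)) = R3 \<U> C x"
  unfolding R3_def integral_mult_right_zero
  by (subst Bochner_Integration.integral_sum) (intro integrable_intros refl)+

text \<open>
  The form in which \<open>abs_sq_bounds\<close> applies: \<open>t\<close> is the main term and the rest its perturbation.
\<close>

lemma sq_bias_eq:
  "sq_bias P X \<U> s x = (t + (expectation m - s x - t))\<^sup>2"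
  by (simp add: sq_bias_def power2_commute)

lemma first_order_bias:
  assumes "first_order_bound s C"
  shows "(M1 \<U> s x)\<^sup>2 - 2 * \<bar>M1 \<U> s x\<bar> * R2 \<U> C x \<le> sq_bias P X \<U> s x"
    and "sq_bias P X \<U> s x \<le> (\<bar>M1 \<U> s x\<bar> + R2 \<U> C x)\<^sup>2"
proof -
  have "\<bar>expectation m - s x - M1 \<U> s x\<bar> \<le> R2 \<U> C x"
    unfolding expectation_slope[symmetric] expectation_first_order_error[symmetric]
    by (rule bias_deviation) (intro bounded_measurable_intros cell_mean_first_order assms; assumption)+
  note abs_sq_bounds[OF this, of "M1 \<U> s x", folded sq_bias_eq]
  then show "(M1 \<U> s x)\<^sup>2 - 2 * \<bar>M1 \<U> s x\<bar> * R2 \<U> C x \<le> sq_bias P X \<U> s x"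
    and "sq_bias P X \<U> s x \<le> (\<bar>M1 \<U> s x\<bar> + R2 \<U> C x)\<^sup>2" by blast+
qed

lemma second_order_bias:
  assumes "second_order_bound s C" "0 \<le> C"
  shows "\<bar>sq_bias P X \<U> s x - (M1 \<U> s x + M2 \<U> s x)\<^sup>2\<bar>
    \<le> 2 * \<bar>R3 \<U> C x * (M1 \<U> s x + M2 \<U> s x)\<bar> + (R3 \<U> C x)\<^sup>2"
proof -
  have "\<bar>expectation m - s x - expectation (\<lambda>U. slope_term U + curvature_term U)\<bar> \<le> R3 \<U> C x"
    unfolding expectation_second_order_error[symmetric]
    by (rule bias_deviation) (intro bounded_measurable_intros cell_mean_second_order assms; assumption)+
  also have "expectation (\<lambda>U. slope_term U + curvature_term U) = M1 \<U> s x + M2 \<U> s x"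
    unfolding expectation_slope[symmetric] expectation_curvature[symmetric]
    by (rule Bochner_Integration.integral_add) (intro integrable_intros)+
  finally show ?thesis
    by (rule abs_sq_bounds(3)[of "expectation m - s x - (M1 \<U> s x + M2 \<U> s x)" _ "M1 \<U> s x + M2 \<U> s x",
          folded sq_bias_eq])
qed

lemma ens_variance_bound:
  assumes bound: "first_order_bound s C"
  shows "\<bar>ens_variance P X \<U> s x - (N2 \<U> s x - (M1 \<U> s x)\<^sup>2)\<bar>
    \<le> 2 * sqrt (R4 \<U> C x * (N2 \<U> s x - (M1 \<U> s x)\<^sup>2)) + R4 \<U> C x"
proof -
  define r where "r U = m U - s x - slope_term U" for U
  have r: "bounded_measurable \<U> r"
    unfolding r_def[abs_def] by (intro bounded_measurable_intros)
  note bm = bounded_measurable_slope r bounded_measurable_cell_mean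
  note int = bm[THEN integrable_bounded_measurable]
  have meas: "slope_term \<in> borel_measurable \<U>" "r \<in> borel_measurable \<U>"
    using int by auto
  have var_slope: "variance slope_term = N2 \<U> s x - (M1 \<U> s x)\<^sup>2"
    by (subst variance_eq) (intro integrable_intros | simp add: expectation_slope expectation_slope_sq)+
  have var_nonneg: "0 \<le> variance slope_term" by simp
  have "expectation (\<lambda>U. slope_term U + r U) = expectation m - s x"
    using int by (simp add: r_def prob_space)
  then have "ens_variance P X \<U> s x = variance (\<lambda>U. slope_term U + r U)"
    by (simp add: ens_variance_def r_def)
  then have pert: "\<bar>ens_variance P X \<U> s x - variance slope_term\<bar>
      \<le> 2 * sqrt (variance slope_term * expectation (\<lambda>U. (r U)\<^sup>2)) + expectation (\<lambda>U. (r U)\<^sup>2)"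
    using variance_add_perturbation[OF meas] int bm
    by (simp add: integrable_bounded_measurable bounded_measurable_power)
  have "expectation (\<lambda>U. (r U)\<^sup>2)
      \<le> expectation (\<lambda>U. 2 * real CARD('n) * C\<^sup>2 / 9 * (\<Sum>i\<in>UNIV. (a U i) ^ 4 + (b U i) ^ 4))"
  proof (rule integral_mono)
    show "integrable \<U> (\<lambda>U. (r U)\<^sup>2)"
      by (intro integrable_intros r)
    show "integrable \<U> (\<lambda>U. 2 * real CARD('n) * C\<^sup>2 / 9 * (\<Sum>i\<in>UNIV. (a U i) ^ 4 + (b U i) ^ 4))"
      by (intro integrable_intros)
    fix U assume U: "U \<in> space \<U>"
    let ?q = "\<lambda>i. (a U i)\<^sup>2 + (b U i)\<^sup>2 - a U i * b U i"
    have q: "(?q i)\<^sup>2 \<le> 2 * ((a U i) ^ 4 + (b U i) ^ 4)" for i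
    proof -
      define u v where "u = a U i" and "v = b U i"
      have uv: "0 \<le> u" "0 \<le> v" using len_bounds[OF U] by (simp_all add: u_def v_def)
      have "0 \<le> u\<^sup>2 + v\<^sup>2 - u * v"
        using sum_squares_bound[of u v] mult_nonneg_nonneg[OF uv] by linarith
      then have "(u\<^sup>2 + v\<^sup>2 - u * v)\<^sup>2 \<le> (u\<^sup>2 + v\<^sup>2)\<^sup>2"
        using uv by (intro power_mono) auto
      also have "\<dots> \<le> 2 * ((u\<^sup>2)\<^sup>2 + (v\<^sup>2)\<^sup>2)"
        using sum_squares_bound[of "u\<^sup>2" "v\<^sup>2"] by (simp add: power2_sum)
      finally show ?thesis by (simp add: u_def v_def)
    qed
    have "(r U)\<^sup>2 \<le> (C / 3 * (\<Sum>i\<in>UNIV. ?q i))\<^sup>2"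
      using power_mono[OF cell_mean_first_order[OF bound U] abs_ge_zero, of 2]
      by (simp only: r_def power2_abs)
    also have "\<dots> = C\<^sup>2 / 9 * (\<Sum>i\<in>UNIV. ?q i)\<^sup>2"
      by (simp add: power_mult_distrib power_divide)
    also have "\<dots> \<le> C\<^sup>2 / 9 * ((\<Sum>i\<in>UNIV. (?q i)\<^sup>2) * real CARD('n))"
      by (intro mult_left_mono sum_squared_le_sum_of_squares) auto
    also have "\<dots> \<le> C\<^sup>2 / 9 * ((\<Sum>i\<in>UNIV. 2 * ((a U i) ^ 4 + (b U i) ^ 4)) * real CARD('n))"
      by (intro mult_left_mono mult_right_mono sum_mono q) auto
    also have "\<dots> = 2 * real CARD('n) * C\<^sup>2 / 9 * (\<Sum>i\<in>UNIV. (a U i) ^ 4 + (b U i) ^ 4)"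
      unfolding sum_distrib_left[symmetric] by simp
    finally show "(r U)\<^sup>2 \<le> 2 * real CARD('n) * C\<^sup>2 / 9 * (\<Sum>i\<in>UNIV. (a U i) ^ 4 + (b U i) ^ 4)" .
  qed
  also have "\<dots> = R4 \<U> C x"
    unfolding R4_def integral_mult_right_zero
    by (subst Bochner_Integration.integral_sum) (intro integrable_intros refl)+
  finally have r4: "expectation (\<lambda>U. (r U)\<^sup>2) \<le> R4 \<U> C x" .
  then have "sqrt (variance slope_term * expectation (\<lambda>U. (r U)\<^sup>2)) \<le> sqrt (R4 \<U> C x * variance slope_term)"
    using var_nonneg by (subst mult.commute[of "variance slope_term"]) (intro real_sqrt_le_mono mult_right_mono)
  with pert r4 show ?thesis
    unfolding var_slope[symmetric] by linarith
qed

end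

section \<open>Bias and variance of the cell mean\<close>

theorem proposition3:
  fixes \<U> :: "(real^'n) set set measure"
    and P :: "'w measure" and X :: "'w \<Rightarrow> real^'n"
    and s :: "real^'n \<Rightarrow> real"
  assumes "random_partition \<U>"
    and "uniform_on_cube P X"
    and "s differentiable_on unit_cube"
  shows "(\<forall>C2>0. first_order_bound s C2 \<longrightarrow>
           (\<forall>x\<in>unit_cube.
              (M1 \<U> s x)\<^sup>2 - 2 * \<bar>M1 \<U> s x\<bar> * R2 \<U> C2 x \<le> sq_bias P X \<U> s x \<and>
              sq_bias P X \<U> s x \<le> (\<bar>M1 \<U> s x\<bar> + R2 \<U> C2 x)\<^sup>2 \<and>
              \<bar>ens_variance P X \<U> s x - (N2 \<U> s x - (M1 \<U> s x)\<^sup>2)\<bar>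
                \<le> 2 * sqrt (R4 \<U> C2 x * (N2 \<U> s x - (M1 \<U> s x)\<^sup>2)) + R4 \<U> C2 x))
       \<and> (\<forall>C3>0. twice_differentiable_on_cube s \<and> second_order_bound s C3 \<longrightarrow>
           (bdd_above (hess_values s) \<and> first_order_bound s (hess_norm s / 2)) \<and>
           (\<forall>x\<in>unit_cube.
              \<bar>sq_bias P X \<U> s x - (M1 \<U> s x + M2 \<U> s x)\<^sup>2\<bar>
                \<le> 2 * \<bar>R3 \<U> C3 x * (M1 \<U> s x + M2 \<U> s x)\<bar> + (R3 \<U> C3 x)\<^sup>2))"
proof (intro conjI allI impI ballI)
  fix C2 :: real and x :: "real^'n"
  assume bound: "first_order_bound s C2" and x: "x \<in> unit_cube"
  obtain M where "\<forall>t\<in>unit_cube. \<bar>s t\<bar> \<le> M"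
    using first_order_bound_imp_bounded[OF bound] by blast
  then interpret random_cell_at \<U> P X s M x
    using assms x by unfold_locales auto
  show "(M1 \<U> s x)\<^sup>2 - 2 * \<bar>M1 \<U> s x\<bar> * R2 \<U> C2 x \<le> sq_bias P X \<U> s x"
    and "sq_bias P X \<U> s x \<le> (\<bar>M1 \<U> s x\<bar> + R2 \<U> C2 x)\<^sup>2"
    by (rule first_order_bias[OF bound])+
  show "\<bar>ens_variance P X \<U> s x - (N2 \<U> s x - (M1 \<U> s x)\<^sup>2)\<bar>
      \<le> 2 * sqrt (R4 \<U> C2 x * (N2 \<U> s x - (M1 \<U> s x)\<^sup>2)) + R4 \<U> C2 x"
    by (rule ens_variance_bound[OF bound])
next
  fix C3 :: real
  assume C3: "0 < C3" and "twice_differentiable_on_cube s \<and> second_order_bound s C3"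
  then have twice: "twice_differentiable_on_cube s" and bound: "second_order_bound s C3" by auto
  show bdd: "bdd_above (hess_values s)"
    using bdd_above_hess_values[OF bound] C3 by simp
  show "first_order_bound s (hess_norm s / 2)"
    by (rule first_order_bound_of_hess_values[OF twice bdd])
  fix x :: "real^'n" assume x: "x \<in> unit_cube"
  obtain M where "\<forall>t\<in>unit_cube. \<bar>s t\<bar> \<le> M"
    using second_order_bound_imp_bounded[OF bound] by blast
  then interpret random_cell_at \<U> P X s M x
    using assms x by unfold_locales auto
  show "\<bar>sq_bias P X \<U> s x - (M1 \<U> s x + M2 \<U> s x)\<^sup>2\<bar>
      \<le> 2 * \<bar>R3 \<U> C3 x * (M1 \<U> s x + M2 \<U> s x)\<bar> + (R3 \<U> C3 x)\<^sup>2"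
    using second_order_bias[OF bound] C3 by simp
qed

end
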